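(* Suppose $K=\bar K$ and $d\ge3$. Let $f\in\mathcal{R}_d$. Assume that $\mathrm{ann}_R(f)_1=0$, and let $\beta_{1j}$ be the minimal number of generators of $\mathrm{ann}_R(f)$ of degree $j$. Then $f$ has a (non-trivial) regular or degenerate splitting, i.e. a regular splitting of length at least $2$ or a degenerate splitting of length at least $2$, if and only if $\beta_{1d}>0$.
   Context: $K$ is a field, $r\ge 1$, $R=K[\partial_1,\dots,\partial_r]$ is a polynomial ring with the standard grading, and $\mathcal{R}=K[x_1,\dots,x_r]^{DP}=\bigoplus_{d\ge0}\mathcal{R}_d$ is the divided power ring: $\mathcal{R}_d$ has $K$-basis $x^{(\alpha)}=\prod_i x_i^{(\alpha_i)}$, $|\alpha|=d$, with multiplication generated by $x_i^{(a)}x_i^{(b)}=\binom{a+b}{a}x_i^{(a+b)}$. $R$ acts on $\mathcal{R}$ by $\partial^\beta(x^{(\alpha)})=x^{(\alpha-\beta)}$ (zero if some $\alpha_i<\beta_i$). $\mathrm{ann}_R(f)=\{D\in R:Df=0\}$, with degree $e$ part $\mathrm{ann}_R(f)_e$; $R_e(f)=\{Df:D\in R_e\}$. A regular splitting of length $m$ of a form $f$ of degree $d$ is an expression $f=g_1+\dots+g_m$ with nonzero forms $g_i$ of degree $d$ such that $R_{d-1}(g_i)\cap\sum_{j\ne i}R_{d-1}(g_j)=0$ for all $i$; one then says $f$ splits regularly $m-1$ times. $f\in\mathcal{R}_d$ has a degenerate splitting of length $m$ if for some $n\ge1$ there exists $f_t\in\mathcal{R}_d[t_1,\dots,t_n]$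 such that $f_0=f$ (value at $t_1=\dots=t_n=0$) and $f_t$ splits regularly $m-1$ times over the field $K(t_1,\dots,t_n)$, i.e. inside the degree $d$ part of $K(t_1,\dots,t_n)[x_1,\dots,x_r]^{DP}$ (with $R$ replaced by $R\otimes_KK(t_1,\dots,t_n)$). *)

theory Defs
  imports
    "HOL-Library.Poly_Mapping"
    "HOL-Computational_Algebra.Computational_Algebra"
begin

text \<open>
  The variables are indexed by a finite type \<open>'r\<close>, and a multi-index \<open>\<alpha>\<close> is an element of
  \<open>'r \<Rightarrow>\<^sub>0 nat\<close>. Elements of \<open>R\<close> and elements of the divided power ring are both finitely
  supported families of coefficients: in the type \<open>mpoly\<close> the family \<open>p\<close> stands for
  \<open>\<Sum>\<^sub>\<beta> p\<^sub>\<beta> \<partial>\<^sup>\<beta>\<close>, and the product of \<^theory>\<open>HOL-Library.Poly_Mapping\<close> is the usual product of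
  polynomials; in the type \<open>dpow\<close> the family \<open>f\<close> stands for \<open>\<Sum>\<^sub>\<alpha> f\<^sub>\<alpha> x\<^bsup>(\<alpha>)\<^esup>\<close>, where \<open>x\<^bsup>(\<alpha>)\<^esup>\<close> is the
  divided power monomial. Only the \<open>R\<close>-module structure of \<open>dpow\<close> is used below; the product
  of \<^theory>\<open>HOL-Library.Poly_Mapping\<close> is not the product of divided powers.
\<close>

type_synonym ('r, 'k) mpoly = "('r \<Rightarrow>\<^sub>0 nat) \<Rightarrow>\<^sub>0 'k"
type_synonym ('r, 'k) dpow = "('r \<Rightarrow>\<^sub>0 nat) \<Rightarrow>\<^sub>0 'k"

definition mdeg :: "('r::finite \<Rightarrow>\<^sub>0 nat) \<Rightarrow> nat" where
  "mdeg \<alpha> = (\<Sum>i\<in>UNIV. Poly_Mapping.lookup \<alpha> i)"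

text \<open>
  The homogeneous elements of degree \<open>e\<close> (zero included) whose coefficients lie in the subring
  \<open>L\<close> of the coefficient type. The parameter \<open>L\<close> is needed because the field
  \<open>K(t\<^sub>1, \<dots>, t\<^sub>n)\<close>, with \<open>n\<close> bound inside a formula, is realised below as a subfield of a type.
\<close>

definition homog :: "'k::zero set \<Rightarrow> nat \<Rightarrow> (('r::finite \<Rightarrow>\<^sub>0 nat) \<Rightarrow>\<^sub>0 'k) set" where
  "homog L e = {p. \<forall>\<alpha>. Poly_Mapping.lookup p \<alpha> \<in> L \<and> (Poly_Mapping.lookup p \<alpha> \<noteq> 0 \<longrightarrow> mdeg \<alpha> = e)}"

text \<open>
  The bilinear extension of \<open>\<partial>\<^sup>\<beta> x\<^bsup>(\<alpha>)\<^esup> = x\<^bsup>(\<alpha> - \<beta>)\<^esup>\<close>. The order on multi-indices is written out,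
  since the library order on \<open>'r \<Rightarrow>\<^sub>0 nat\<close> is lexicographic.
\<close>

definition contract :: "('r, 'k::comm_ring_1) mpoly \<Rightarrow> ('r, 'k) dpow \<Rightarrow> ('r, 'k) dpow" where
  "contract D f = (\<Sum>\<beta>\<in>Poly_Mapping.keys D. \<Sum>\<alpha>\<in>Poly_Mapping.keys f.
     if \<forall>i. Poly_Mapping.lookup \<beta> i \<le> Poly_Mapping.lookup \<alpha> i
     then Poly_Mapping.single (\<alpha> - \<beta>) (Poly_Mapping.lookup D \<beta> * Poly_Mapping.lookup f \<alpha>)
     else 0)"

definition ann :: "('r, 'k::comm_ring_1) dpow \<Rightarrow> ('r, 'k) mpoly set" where
  "ann f = {D. contract D f = 0}"

definition derivs :: "'k::comm_ring_1 set \<Rightarrow> nat \<Rightarrow> ('r::finite, 'k) dpow \<Rightarrow> ('r, 'k) dpow set" where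
  "derivs L e f = {contract D f | D. D \<in> homog L e}"

text \<open>
  For a homogeneous ideal \<open>I\<close>: the least possible number of elements of degree \<open>j\<close> in a finite
  homogeneous generating set. By the graded Nakayama lemma every minimal homogeneous
  generating set attains these minima, simultaneously for all \<open>j\<close>. The ideal generated by
  \<open>G\<close> is its span in \<open>R\<close> as a module over itself.
\<close>

definition min_num_gens :: "('r::finite, 'k::comm_ring_1) mpoly set \<Rightarrow> nat \<Rightarrow> nat" where
  "min_num_gens I j = (LEAST c. \<exists>G. finite G \<and> G \<subseteq> (\<Union>e. homog UNIV e) - {0} \<and>
     module.span (*) G = I \<and> c = card (G \<inter> homog UNIV j))"

text \<open>
  Regular splittings of length \<open>m\<close>, over a subfield \<open>L\<close> of the coefficient type, of a form of
  degree \<open>d\<close>. The second operand of the intersection is the sum of the subspaces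
  \<open>R\<^bsub>d-1\<^esub>(g\<^sub>j)\<close> with \<open>j \<noteq> i\<close>.
\<close>

definition regular_splitting ::
    "'k::comm_ring_1 set \<Rightarrow> nat \<Rightarrow> nat \<Rightarrow> ('r::finite, 'k) dpow \<Rightarrow> bool" where
  "regular_splitting L d m f \<longleftrightarrow>
     (\<exists>g :: nat \<Rightarrow> ('r, 'k) dpow.
        f = (\<Sum>i<m. g i) \<and>
        (\<forall>i<m. g i \<in> homog L d \<and> g i \<noteq> 0) \<and>
        (\<forall>i<m. derivs L (d - 1) (g i) \<inter>
            {\<Sum>j\<in>{..<m} - {i}. h j | h. \<forall>j\<in>{..<m} - {i}. h j \<in> derivs L (d - 1) (g j)} = {0}))"

text \<open>
  \<open>tpolys n\<close> is \<open>K[t\<^sub>1, \<dots>, t\<^sub>n]\<close> (with variables numbered from \<open>0\<close>) inside the polynomial ring in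
  countably many variables, and \<open>ratfuns n\<close> is its field of fractions \<open>K(t\<^sub>1, \<dots>, t\<^sub>n)\<close>.
\<close>

type_synonym 'k tpoly = "(nat \<Rightarrow>\<^sub>0 nat) \<Rightarrow>\<^sub>0 'k"

definition tpolys :: "nat \<Rightarrow> 'k::zero tpoly set" where
  "tpolys n = {p. \<forall>\<gamma>\<in>Poly_Mapping.keys p. Poly_Mapping.keys \<gamma> \<subseteq> {..<n}}"

definition ratfuns :: "nat \<Rightarrow> 'k::field tpoly fract set" where
  "ratfuns n = {Fract a b | a b. a \<in> tpolys n \<and> b \<in> tpolys n \<and> b \<noteq> 0}"

text \<open>
  \<open>F\<close> plays the role of \<open>f\<^sub>t \<in> \<R>\<^sub>d[t\<^sub>1, \<dots>, t\<^sub>n]\<close>, written as a form of degree \<open>d\<close> with coefficients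
  in \<open>K[t\<^sub>1, \<dots>, t\<^sub>n]\<close>; \<open>Poly_Mapping.lookup p 0\<close> is the constant term of \<open>p\<close>, that is, its value at
  \<open>t = 0\<close>.
\<close>

definition degenerate_splitting :: "nat \<Rightarrow> nat \<Rightarrow> ('r::finite, 'k::field) dpow \<Rightarrow> bool" where
  "degenerate_splitting d m f \<longleftrightarrow>
     (\<exists>n\<ge>1. \<exists>F :: ('r, 'k tpoly) dpow.
        F \<in> homog (tpolys n) d \<and>
        Poly_Mapping.map (\<lambda>p. Poly_Mapping.lookup p 0) F = f \<and>
        regular_splitting (ratfuns n) d m (Poly_Mapping.map (\<lambda>p. Fract p 1) F))"

end

theory Submission
  imports Defs "HOL-Analysis.Cartesian_Space"
begin

text \<open>
  Write \<open>\<nabla>f\<close> for the vector of the first derivatives \<open>\<partial>\<^sub>i f\<close>. A square matrix \<open>A\<close>, with rows and columns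
  indexed by the variables, is called self-adjoint for \<open>f\<close> if \<open>A\<close> times the Hessian of \<open>f\<close> is symmetric.
  This is the integrability condition for \<open>\<nabla>g = A \<nabla>f\<close> (\<open>primitive_exists\<close>). A scalar matrix \<open>c\<close> is
  self-adjoint, with \<open>g = c f\<close>; conversely, \<open>A\<close> is scalar if \<open>g\<close> is a multiple of \<open>f\<close>, because
  \<open>ann(f)\<^sub>1 = 0\<close>. The idea of the proof is that both sides of the equivalence say that some
  self-adjoint matrix is not scalar.

  Generators. The partial derivatives of a form \<open>g\<close> of degree \<open>d\<close> are combinations of those of \<open>f\<close> if and only
  if \<open>g\<close> is orthogonal to \<open>R\<^sub>1 ann(f)\<^bsub>d-1\<^esub>\<close>, and \<open>g\<close> is a multiple of \<open>f\<close> if and only if it is orthogonal to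
  \<open>ann(f)\<^sub>d\<close>. Hence there is a non-scalar self-adjoint matrix exactly if these two spaces
  differ, that is, if generators of degree \<open>d\<close> are needed (\<open>nonscalar_imp_min_num_gens_pos\<close>,
  \<open>min_num_gens_pos_imp_nonscalar\<close>).

  From splittings to matrices. If \<open>f = \<Sum> g\<^sub>i\<close> is a regular splitting, every operator of degree \<open>d - 1\<close> that
  kills \<open>f\<close> kills each \<open>g\<^sub>i\<close>, so \<open>\<nabla>g\<^sub>i = A\<^sub>i \<nabla>f\<close>, and the \<open>A\<^sub>i\<close> are not all scalar
  (\<open>regular_splitting_imp_nonscalar\<close>). For a degenerate splitting this gives a non-scalar matrix over
  \<open>K(t\<^sub>1, \<dots>, t\<^sub>n)\<close>. Self-adjointness being a system of linear equations, the terms of lowest degree in \<open>t\<close> of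
  a suitable multiple are a solution at \<open>t = 0\<close> (\<open>nonscalar_specialization\<close>).

  From matrices to splittings. Polynomials in a self-adjoint matrix are self-adjoint. Over an
  algebraically closed field, the algebra generated by a non-scalar matrix contains an idempotent
  \<open>E\<close> other than \<open>0\<close> and \<open>1\<close>, or a matrix \<open>A \<noteq> 0\<close> with \<open>A\<^sup>2 = 0\<close>. In the first case \<open>\<nabla>g = E \<nabla>f\<close> yields the
  regular splitting \<open>f = g + (f - g)\<close>. In the second case let \<open>\<nabla>g = A \<nabla>f\<close>, choose \<open>S\<close> with \<open>A S A = A\<close>, and let
  \<open>G = g + t g\<^sub>1 + \<dots>\<close> be the form that arises from \<open>g\<close> by the linear substitution with matrix \<open>1 + t S\<close>.
  Then \<open>f\<^sub>t = G / t + (f - g\<^sub>1 - g / t)\<close> is polynomial in \<open>t\<close>, specializes to \<open>f\<close> and splits regularly into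
  the two summands displayed (\<open>square_zero_imp_degenerate_splitting\<close>). The model case is the limit
  \<open>x\<^bsup>(d-1)\<^esup> y = lim ((x + t y)\<^bsup>(d)\<^esup> - x\<^bsup>(d)\<^esup>) / t\<close>.
\<close>

(* In this theory the symbol $ stands for the entries of vectors and matrices only. *)
no_notation fps_nth (infixl \<open>$\<close> 75)

section \<open>Monomials, forms and the pairing with differential operators\<close>

definition var :: "'r \<Rightarrow> ('r \<Rightarrow>\<^sub>0 nat)" where
  "var i = Poly_Mapping.single i 1"

lemma lookup_var: "Poly_Mapping.lookup (var i) j = (if i = j then 1 else 0)"
  by (simp add: var_def lookup_single)

lemma mdeg_add [simp]: "mdeg (\<alpha> + \<beta>) = mdeg \<alpha> + mdeg \<beta>"
  by (simp add: mdeg_def lookup_add sum.distrib)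

lemma mdeg_zero [simp]: "mdeg 0 = 0"
  by (simp add: mdeg_def)

lemma mdeg_var [simp]: "mdeg (var i) = 1"
  by (simp add: mdeg_def lookup_var)

lemma mdeg_eq_0_iff [simp]: "mdeg \<alpha> = 0 \<longleftrightarrow> \<alpha> = 0"
  by (auto simp: mdeg_def intro: poly_mapping_eqI)

lemma diff_var_add:
  assumes "Poly_Mapping.lookup \<alpha> i > 0"
  shows "\<alpha> - var i + var i = \<alpha>"
  using assms by (intro poly_mapping_eqI) (auto simp: lookup_add lookup_minus lookup_var)

lemma mdeg_SucE:
  assumes "mdeg \<alpha> = Suc n"
  obtains i \<beta> where "\<alpha> = \<beta> + var i" "mdeg \<beta> = n"
proof -
  have "\<alpha> \<noteq> 0" using assms by auto
  then obtain i where i: "Poly_Mapping.lookup \<alpha> i > 0"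
    by (metis (no_types, lifting) gr0I lookup_zero poly_mapping_eqI)
  have "mdeg (\<alpha> - var i + var i) = Suc n"
    using diff_var_add[OF i] assms by simp
  hence "mdeg (\<alpha> - var i) = n" by simp
  thus thesis using that[of "\<alpha> - var i" i] diff_var_add[OF i] by simp
qed

lemma finite_mdeg [simp]: "finite {\<alpha>::'r::finite \<Rightarrow>\<^sub>0 nat. mdeg \<alpha> = e}"
proof (induction e)
  case (Suc e)
  have "{\<alpha>::'r \<Rightarrow>\<^sub>0 nat. mdeg \<alpha> = Suc e} \<subseteq> (\<lambda>(\<beta>, i). \<beta> + var i) ` ({\<alpha>. mdeg \<alpha> = e} \<times> UNIV)"
    by (force elim!: mdeg_SucE)
  thus ?case by (rule finite_subset) (use Suc in auto)
qed simp

lemma monomial_factor: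
  assumes "n \<le> mdeg \<alpha>"
  obtains \<beta> \<gamma> where "\<alpha> = \<beta> + \<gamma>" "mdeg \<gamma> = n"
proof -
  have "\<exists>\<beta> \<gamma>. \<alpha> = \<beta> + \<gamma> \<and> mdeg \<gamma> = n"
    using assms
  proof (induction "mdeg \<alpha> - n" arbitrary: \<alpha>)
    case 0
    thus ?case by (intro exI[of _ 0] exI[of _ \<alpha>]) auto
  next
    case (Suc k)
    then obtain m where "mdeg \<alpha> = Suc m" by (cases "mdeg \<alpha>") auto
    then obtain i \<delta> where d: "\<alpha> = \<delta> + var i" "mdeg \<delta> = m" by (rule mdeg_SucE)
    have "k = mdeg \<delta> - n" "n \<le> mdeg \<delta>"
      using Suc d \<open>mdeg \<alpha> = Suc m\<close> by auto
    then obtain \<beta> \<gamma> where "\<delta> = \<beta> + \<gamma>" "mdeg \<gamma> = n" using Suc by blast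
    thus ?case using d by (intro exI[of _ "\<beta> + var i"] exI[of _ \<gamma>]) (simp add: ac_simps)
  qed
  thus thesis using that by blast
qed

lemma homog_iff:
  "p \<in> homog L e \<longleftrightarrow> (\<forall>\<alpha>. Poly_Mapping.lookup p \<alpha> \<in> L) \<and> (\<forall>\<alpha>. mdeg \<alpha> \<noteq> e \<longrightarrow> Poly_Mapping.lookup p \<alpha> = 0)"
  by (auto simp: homog_def)

lemma homog_eqI:
  assumes "p \<in> homog L e" "q \<in> homog L' e"
    and "\<And>\<alpha>. mdeg \<alpha> = e \<Longrightarrow> Poly_Mapping.lookup p \<alpha> = Poly_Mapping.lookup q \<alpha>"
  shows "p = q"
  by (rule poly_mapping_eqI) (use assms in \<open>metis homog_iff\<close>)

definition form_of :: "nat \<Rightarrow> (('r::finite \<Rightarrow>\<^sub>0 nat) \<Rightarrow> 'k::zero) \<Rightarrow> ('r \<Rightarrow>\<^sub>0 nat) \<Rightarrow>\<^sub>0 'k" where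
  "form_of e \<phi> = Abs_poly_mapping (\<lambda>\<alpha>. \<phi> \<alpha> when mdeg \<alpha> = e)"

lemma lookup_form_of: "Poly_Mapping.lookup (form_of e \<phi>) \<alpha> = (\<phi> \<alpha> when mdeg \<alpha> = e)"
proof -
  have "finite {\<alpha>. (\<phi> \<alpha> when mdeg \<alpha> = e) \<noteq> 0}"
    by (rule finite_subset[OF _ finite_mdeg[of e]]) (auto simp: when_def)
  thus ?thesis unfolding form_of_def by simp
qed

lemma form_of_homog:
  "0 \<in> L \<Longrightarrow> (\<And>\<alpha>. mdeg \<alpha> = e \<Longrightarrow> \<phi> \<alpha> \<in> L) \<Longrightarrow> form_of e \<phi> \<in> homog L e"
  by (auto simp: homog_iff lookup_form_of when_def)

text \<open>
  The pairing of an operator \<open>D\<close> with a family \<open>\<phi>\<close> of numbers is the value at \<open>D\<close> of the linear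
  functional on \<open>R\<close> that takes the value \<open>\<phi> \<beta>\<close> at \<open>\<partial>\<^sup>\<beta>\<close>. For the coefficients \<open>\<phi>\<close> of a divided power
  form it is the constant term of the contraction. Since \<open>\<phi>\<close> need not have finite support, it
  serves also for the shifted families that appear in the other coefficients.
\<close>

definition pairing :: "(('r \<Rightarrow>\<^sub>0 nat) \<Rightarrow>\<^sub>0 'k::comm_ring_1) \<Rightarrow> (('r \<Rightarrow>\<^sub>0 nat) \<Rightarrow> 'k) \<Rightarrow> 'k" where
  "pairing D \<phi> = (\<Sum>\<beta>\<in>Poly_Mapping.keys D. Poly_Mapping.lookup D \<beta> * \<phi> \<beta>)"

lemma pairing_superset:
  assumes "finite S" "Poly_Mapping.keys D \<subseteq> S"
  shows "pairing D \<phi> = (\<Sum>\<beta>\<in>S. Poly_Mapping.lookup D \<beta> * \<phi> \<beta>)"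
  unfolding pairing_def by (rule sum.mono_neutral_left) (use assms in \<open>auto simp: in_keys_iff\<close>)

lemma pairing_homog:
  assumes "D \<in> homog L e"
  shows "pairing D \<phi> = (\<Sum>\<beta> | mdeg \<beta> = e. Poly_Mapping.lookup D \<beta> * \<phi> \<beta>)"
  by (rule pairing_superset) (use assms in \<open>auto simp: homog_def in_keys_iff\<close>)

lemma pairing_add: "pairing (D + E) \<phi> = pairing D \<phi> + pairing E \<phi>"
proof -
  let ?S = "Poly_Mapping.keys D \<union> Poly_Mapping.keys E"
  have "pairing (D + E) \<phi> = (\<Sum>\<beta>\<in>?S. Poly_Mapping.lookup (D + E) \<beta> * \<phi> \<beta>)"
    by (rule pairing_superset) (auto simp: keys_add)
  also have "\<dots> = (\<Sum>\<beta>\<in>?S. Poly_Mapping.lookup D \<beta> * \<phi> \<beta>) + (\<Sum>\<beta>\<in>?S. Poly_Mapping.lookup E \<beta> * \<phi> \<beta>)"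
    by (simp add: lookup_add algebra_simps sum.distrib)
  also have "\<dots> = pairing D \<phi> + pairing E \<phi>"
    by (subst (1 2) pairing_superset[symmetric]) auto
  finally show ?thesis .
qed

lemma pairing_zero [simp]: "pairing 0 \<phi> = 0"
  by (simp add: pairing_def)

lemma pairing_single [simp]: "pairing (Poly_Mapping.single \<beta> c) \<phi> = c * \<phi> \<beta>"
  by (cases "c = 0") (auto simp: pairing_def)

lemma pairing_sum: "pairing (\<Sum>x\<in>X. D x) \<phi> = (\<Sum>x\<in>X. pairing (D x) \<phi>)"
  by (induction X rule: infinite_finite_induct) (auto simp: pairing_add)

lemma poly_mapping_sum_single: "D = (\<Sum>\<beta>\<in>Poly_Mapping.keys D. Poly_Mapping.single \<beta> (Poly_Mapping.lookup D \<beta>))"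
  by (rule poly_mapping_eqI) (auto simp: lookup_sum lookup_single when_def in_keys_iff)

lemma pairing_mult:
  "pairing (D * E) \<phi> = pairing D (\<lambda>\<beta>. pairing E (\<lambda>\<gamma>. \<phi> (\<beta> + \<gamma>)))"
proof -
  let ?D = "Poly_Mapping.keys D" and ?E = "Poly_Mapping.keys E"
  have "pairing (D * E) \<phi> = pairing ((\<Sum>\<beta>\<in>?D. Poly_Mapping.single \<beta> (Poly_Mapping.lookup D \<beta>)) *
      (\<Sum>\<gamma>\<in>?E. Poly_Mapping.single \<gamma> (Poly_Mapping.lookup E \<gamma>))) \<phi>"
    by (simp add: poly_mapping_sum_single[symmetric])
  also have "\<dots> = (\<Sum>\<beta>\<in>?D. \<Sum>\<gamma>\<in>?E. Poly_Mapping.lookup D \<beta> * Poly_Mapping.lookup E \<gamma> * \<phi> (\<beta> + \<gamma>))"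
    by (simp add: sum_product pairing_sum mult_single)
  finally show ?thesis by (simp add: pairing_def sum_distrib_left mult.assoc)
qed

lemma pairing_linear:
  "pairing D (\<lambda>\<beta>. \<phi> \<beta> + \<psi> \<beta>) = pairing D \<phi> + pairing D \<psi>"
  "pairing D (\<lambda>\<beta>. \<phi> \<beta> - \<psi> \<beta>) = pairing D \<phi> - pairing D \<psi>"
  "pairing D (\<lambda>\<beta>. c * \<phi> \<beta>) = c * pairing D \<phi>"
  "pairing D (\<lambda>\<beta>. \<Sum>x\<in>X. \<theta> x \<beta>) = (\<Sum>x\<in>X. pairing D (\<theta> x))"
  "pairing D (\<lambda>\<beta>. 0) = 0"
  by (auto simp: pairing_def algebra_simps sum.distrib sum_distrib_left sum_subtractf intro: sum.swap)

lemma lookup_contract: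
  "Poly_Mapping.lookup (contract D f) \<alpha> = pairing D (\<lambda>\<beta>. Poly_Mapping.lookup f (\<alpha> + \<beta>))"
proof -
  have key: "(\<Sum>\<gamma>\<in>Poly_Mapping.keys f. Poly_Mapping.lookup
      (if \<forall>i. Poly_Mapping.lookup \<beta> i \<le> Poly_Mapping.lookup \<gamma> i
       then Poly_Mapping.single (\<gamma> - \<beta>) (Poly_Mapping.lookup D \<beta> * Poly_Mapping.lookup f \<gamma>)
       else 0) \<alpha>) = Poly_Mapping.lookup D \<beta> * Poly_Mapping.lookup f (\<alpha> + \<beta>)" for \<beta>
  proof -
    have eq: "(\<forall>i. Poly_Mapping.lookup \<beta> i \<le> Poly_Mapping.lookup \<gamma> i) \<and> \<gamma> - \<beta> = \<alpha> \<longleftrightarrow> \<gamma> = \<alpha> + \<beta>" for \<gamma>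
      by (auto simp: lookup_add poly_mapping_eq_iff fun_eq_iff lookup_minus) (metis le_add_diff_inverse2)
    have "(\<Sum>\<gamma>\<in>Poly_Mapping.keys f. Poly_Mapping.lookup
      (if \<forall>i. Poly_Mapping.lookup \<beta> i \<le> Poly_Mapping.lookup \<gamma> i
       then Poly_Mapping.single (\<gamma> - \<beta>) (Poly_Mapping.lookup D \<beta> * Poly_Mapping.lookup f \<gamma>)
       else 0) \<alpha>) = (\<Sum>\<gamma>\<in>Poly_Mapping.keys f. if \<gamma> = \<alpha> + \<beta> then
         Poly_Mapping.lookup D \<beta> * Poly_Mapping.lookup f (\<alpha> + \<beta>) else 0)"
      by (rule sum.cong[OF refl]) (use eq in \<open>auto simp: lookup_single when_def\<close>)
    thus ?thesis by (auto simp: in_keys_iff)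
  qed
  show ?thesis
    unfolding contract_def pairing_def by (simp add: lookup_sum key)
qed

lemma contract_add_left: "contract (D + E) f = contract D f + contract E f"
  by (rule poly_mapping_eqI) (simp add: lookup_contract lookup_add pairing_add)

lemma contract_add_right: "contract D (f + g) = contract D f + contract D g"
  by (rule poly_mapping_eqI) (simp add: lookup_contract lookup_add pairing_linear)

lemma contract_zero [simp]: "contract 0 f = 0" "contract D 0 = 0"
  by (auto intro!: poly_mapping_eqI simp: lookup_contract pairing_linear)

lemma contract_uminus: "contract (- D) f = - contract D f"
  using contract_add_left[of D "- D" f] by (simp add: eq_neg_iff_add_eq_0 add.commute)

lemma contract_sum_right: "contract D (\<Sum>x\<in>X. f x) = (\<Sum>x\<in>X. contract D (f x))"
  by (induction X rule: infinite_finite_induct) (auto simp: contract_add_right)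

lemma contract_mult: "contract (D * E) f = contract D (contract E f)"
  by (rule poly_mapping_eqI) (simp add: lookup_contract pairing_mult add.assoc)

lemma contract_homog_eq_0:
  assumes "D \<in> homog L e" "f \<in> homog L' d"
    and "\<And>\<alpha>. mdeg \<alpha> + e = d \<Longrightarrow> Poly_Mapping.lookup (contract D f) \<alpha> = 0"
  shows "contract D f = 0"
proof (rule poly_mapping_eqI)
  fix \<alpha>
  show "Poly_Mapping.lookup (contract D f) \<alpha> = Poly_Mapping.lookup 0 \<alpha>"
  proof (cases "mdeg \<alpha> + e = d")
    case False
    hence "\<And>\<beta>. mdeg \<beta> = e \<Longrightarrow> Poly_Mapping.lookup f (\<alpha> + \<beta>) = 0"
      using assms(2) by (auto simp: homog_iff)
    thus ?thesis using assms(1) by (simp add: lookup_contract pairing_homog)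
  qed (use assms in simp)
qed

section \<open>Linear algebra\<close>

text \<open>
  The field \<open>K(t\<^sub>1, \<dots>, t\<^sub>n)\<close> is only a subset of a type, and operators with coefficients in it are
  the ones that occur in a degenerate splitting. Duality is therefore needed over a subfield \<open>L\<close> of the
  coefficient type.
\<close>

definition is_subfield :: "'q::field set \<Rightarrow> bool" where
  "is_subfield L \<longleftrightarrow> 0 \<in> L \<and> 1 \<in> L \<and> (\<forall>x\<in>L. \<forall>y\<in>L. x - y \<in> L \<and> x * y \<in> L \<and> x / y \<in> L)"

lemma is_subfieldD:
  assumes "is_subfield L"
  shows "0 \<in> L" "1 \<in> L" "x \<in> L \<Longrightarrow> y \<in> L \<Longrightarrow> x - y \<in> L" "x \<in> L \<Longrightarrow> y \<in> L \<Longrightarrow> x * y \<in> L"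
    "x \<in> L \<Longrightarrow> y \<in> L \<Longrightarrow> x / y \<in> L" "x \<in> L \<Longrightarrow> - x \<in> L" "x \<in> L \<Longrightarrow> y \<in> L \<Longrightarrow> x + y \<in> L"
proof -
  note * = assms[unfolded is_subfield_def]
  show "0 \<in> L" "1 \<in> L" "x \<in> L \<Longrightarrow> y \<in> L \<Longrightarrow> x - y \<in> L" "x \<in> L \<Longrightarrow> y \<in> L \<Longrightarrow> x * y \<in> L"
    "x \<in> L \<Longrightarrow> y \<in> L \<Longrightarrow> x / y \<in> L" using * by auto
  show neg: "x \<in> L \<Longrightarrow> - x \<in> L" for x using * by (metis diff_0)
  show "x \<in> L \<Longrightarrow> y \<in> L \<Longrightarrow> x + y \<in> L" using * neg[of y] by (metis diff_minus_eq_add)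
qed

lemma is_subfield_UNIV: "is_subfield UNIV"
  by (simp add: is_subfield_def)

lemma is_subfield_sum:
  "is_subfield L \<Longrightarrow> (\<And>x. x \<in> X \<Longrightarrow> f x \<in> L) \<Longrightarrow> (\<Sum>x\<in>X. f x) \<in> L"
  by (induction X rule: infinite_finite_induct) (auto simp: is_subfieldD)

text \<open>
  Gaussian elimination, one coordinate at a time: if some vector of \<open>V\<close> has a nonzero entry at \<open>x\<close>, it
  is used to clear that entry in all others, and the functional found on the remaining
  coordinates is extended so as to vanish on this vector.
\<close>

lemma separating_functional:
  fixes v :: "'a \<Rightarrow> 'q::field"
  assumes "finite X" and L: "is_subfield L"
    and "V \<noteq> {}" and "\<And>u w c. u \<in> V \<Longrightarrow> w \<in> V \<Longrightarrow> c \<in> L \<Longrightarrow> (\<lambda>x. u x + c * w x) \<in> V"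
    and "\<And>u x. u \<in> V \<Longrightarrow> x \<in> X \<Longrightarrow> u x \<in> L" and "\<And>x. x \<in> X \<Longrightarrow> v x \<in> L"
    and "\<not> (\<exists>u\<in>V. \<forall>x\<in>X. u x = v x)"
  shows "\<exists>g. (\<forall>x. g x \<in> L) \<and> (\<forall>u\<in>V. (\<Sum>x\<in>X. g x * u x) = 0) \<and> (\<Sum>x\<in>X. g x * v x) \<noteq> 0"
  using assms(1,3-)
proof (induction X arbitrary: V v rule: finite_induct)
  case empty
  thus ?case by auto
next
  case (insert x X)
  note closed = insert.prems(2) and inL = insert.prems(3) and vL = insert.prems(4)
    and notin = insert.prems(5)
  show ?case
  proof (cases "\<exists>u\<in>V. u x \<noteq> 0")
    case True
    then obtain u where u: "u \<in> V" "u x \<noteq> 0" by blast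
    have uL: "u y \<in> L" if "y \<in> insert x X" for y using inL u that by blast
    define V' where "V' = {w \<in> V. w x = 0}"
    define c where "c = v x / u x"
    have cL: "c \<in> L" unfolding c_def using vL uL by (simp add: is_subfieldD[OF L])
    have "(\<lambda>y. u y + (- 1) * u y) \<in> V'"
      using closed[OF u(1) u(1), of "- 1"] by (auto simp: V'_def is_subfieldD[OF L])
    hence ne: "V' \<noteq> {}" by blast
    have "\<not> (\<exists>w\<in>V'. \<forall>y\<in>X. w y = v y - c * u y)"
    proof
      assume "\<exists>w\<in>V'. \<forall>y\<in>X. w y = v y - c * u y"
      then obtain w where w: "w \<in> V" "w x = 0" "\<forall>y\<in>X. w y = v y - c * u y"
        by (auto simp: V'_def)
      hence "(\<lambda>y. w y + c * u y) \<in> V" using closed u cL by blast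
      moreover have "\<forall>y\<in>insert x X. w y + c * u y = v y" using w u by (auto simp: c_def)
      ultimately have "\<exists>u\<in>V. \<forall>y\<in>insert x X. u y = v y" by (intro bexI[of _ "\<lambda>y. w y + c * u y"])
      thus False using notin by blast
    qed
    hence "\<exists>g. (\<forall>y. g y \<in> L) \<and> (\<forall>w\<in>V'. (\<Sum>y\<in>X. g y * w y) = 0) \<and>
        (\<Sum>y\<in>X. g y * (v y - c * u y)) \<noteq> 0"
      by (intro insert.IH ne)
        (use closed inL vL uL cL in \<open>auto simp: V'_def is_subfieldD[OF L]\<close>)
    then obtain g where gL: "\<And>y. g y \<in> L" and g: "\<And>w. w \<in> V' \<Longrightarrow> (\<Sum>y\<in>X. g y * w y) = 0"
      and gv: "(\<Sum>y\<in>X. g y * (v y - c * u y)) \<noteq> 0" by blast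
    define s where "s = (\<Sum>y\<in>X. g y * u y)"
    have sL: "s \<in> L" unfolding s_def
      by (intro is_subfield_sum[OF L]) (use gL uL in \<open>auto simp: is_subfieldD[OF L]\<close>)
    define h where "h = g(x := - (s / u x))"
    have h: "(\<Sum>y\<in>insert x X. h y * w y) = (\<Sum>y\<in>X. g y * (w y - (w x / u x) * u y))" for w
    proof -
      have "(\<Sum>y\<in>insert x X. h y * w y) = - (s / u x) * w x + (\<Sum>y\<in>X. g y * w y)"
        using insert.hyps by (auto simp: h_def intro!: sum.cong)
      also have "\<dots> = (\<Sum>y\<in>X. g y * w y) - (w x / u x) * s" by simp
      also have "\<dots> = (\<Sum>y\<in>X. g y * (w y - (w x / u x) * u y))"
        by (simp add: s_def sum_distrib_left sum_subtractf algebra_simps)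
      finally show ?thesis .
    qed
    have "(\<Sum>y\<in>insert x X. h y * w y) = 0" if "w \<in> V" for w
    proof -
      have "(\<lambda>y. w y + (- (w x / u x)) * u y) \<in> V"
        by (intro closed that u) (use inL[OF that] uL in \<open>simp add: is_subfieldD[OF L]\<close>)
      hence "(\<lambda>y. w y + (- (w x / u x)) * u y) \<in> V'" using u by (simp add: V'_def)
      from g[OF this] show ?thesis unfolding h by simp
    qed
    moreover have "(\<Sum>y\<in>insert x X. h y * v y) \<noteq> 0" unfolding h using gv by (simp add: c_def)
    moreover have "h y \<in> L" for y
      using gL sL uL by (auto simp: h_def is_subfieldD[OF L])
    ultimately show ?thesis by blast
  next
    case False
    hence V0: "u x = 0" if "u \<in> V" for u using that by blast
    show ?thesis
    proof (cases "v x = 0")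
      case True
      hence "\<not> (\<exists>u\<in>V. \<forall>y\<in>X. u y = v y)" using notin V0 by auto
      hence "\<exists>g. (\<forall>y. g y \<in> L) \<and> (\<forall>w\<in>V. (\<Sum>y\<in>X. g y * w y) = 0) \<and> (\<Sum>y\<in>X. g y * v y) \<noteq> 0"
        by (intro insert.IH insert.prems(1)) (use closed inL vL in auto)
      then obtain g where g: "\<forall>y. g y \<in> L" "\<forall>w\<in>V. (\<Sum>y\<in>X. g y * w y) = 0" "(\<Sum>y\<in>X. g y * v y) \<noteq> 0"
        by blast
      thus ?thesis using insert.hyps V0 True by (intro exI[of _ g]) auto
    next
      case False
      have "(\<Sum>y\<in>insert x X. (if y = x then 1 else 0) * w y) = w x" for w :: "'a \<Rightarrow> 'q"
        using insert.hyps by (simp add: if_distrib[of "\<lambda>c. c * _"] cong: if_cong)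
      thus ?thesis using False V0
        by (intro exI[of _ "\<lambda>y. if y = x then 1 else 0"]) (auto simp: is_subfieldD[OF L])
    qed
  qed
qed

lemma finite_spanning_set:
  fixes V :: "('a \<Rightarrow> 'q::field) set"
  assumes "finite X" and "V \<noteq> {}"
    and "\<And>u w c. u \<in> V \<Longrightarrow> w \<in> V \<Longrightarrow> (\<lambda>x. u x + c * w x) \<in> V"
  shows "\<exists>G. finite G \<and> G \<subseteq> V \<and> (\<forall>u\<in>V. \<exists>c. \<forall>x\<in>X. u x = (\<Sum>g\<in>G. c g * g x))"
  using assms
proof (induction X arbitrary: V rule: finite_induct)
  case empty
  thus ?case by (intro exI[of _ "{}"]) auto
next
  case (insert x X)
  note closed = insert.prems(2)
  show ?case
  proof (cases "\<exists>u\<in>V. u x \<noteq> 0")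
    case True
    then obtain u where u: "u \<in> V" "u x \<noteq> 0" by blast
    define V' where "V' = {w \<in> V. w x = 0}"
    have "(\<lambda>y. u y + (- 1) * u y) \<in> V'"
      using closed[OF u(1) u(1), of "- 1"] by (auto simp: V'_def)
    hence "V' \<noteq> {}" by blast
    hence "\<exists>G. finite G \<and> G \<subseteq> V' \<and> (\<forall>u\<in>V'. \<exists>c. \<forall>x\<in>X. u x = (\<Sum>g\<in>G. c g * g x))"
      by (intro insert.IH) (use closed in \<open>auto simp: V'_def\<close>)
    then obtain G where G: "finite G" "G \<subseteq> V'"
      "\<And>w. w \<in> V' \<Longrightarrow> \<exists>c. \<forall>y\<in>X. w y = (\<Sum>g\<in>G. c g * g y)" by blast
    have uG: "u \<notin> G" using G(2) u by (auto simp: V'_def)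
    have "\<exists>c. \<forall>y\<in>insert x X. w y = (\<Sum>g\<in>insert u G. c g * g y)" if w: "w \<in> V" for w
    proof -
      define k where "k = w x / u x"
      have "(\<lambda>y. w y + (- k) * u y) \<in> V'" using closed[OF w u(1), of "- k"] u by (simp add: V'_def k_def)
      from G(3)[OF this] obtain c where c: "\<And>y. y \<in> X \<Longrightarrow> w y + (- k) * u y = (\<Sum>g\<in>G. c g * g y)"
        by blast
      have *: "(\<Sum>g\<in>insert u G. (c(u := k)) g * g y) = k * u y + (\<Sum>g\<in>G. c g * g y)" for y
        using G(1) uG by (auto intro!: sum.cong)
      have "(\<Sum>g\<in>G. c g * g x) = 0" using G(2) by (intro sum.neutral) (auto simp: V'_def)
      hence "\<forall>y\<in>insert x X. w y = (\<Sum>g\<in>insert u G. (c(u := k)) g * g y)"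
        unfolding * using c u by (auto simp: k_def algebra_simps)
      thus ?thesis by blast
    qed
    thus ?thesis using G u by (intro exI[of _ "insert u G"]) (auto simp: V'_def)
  next
    case False
    have "\<exists>G. finite G \<and> G \<subseteq> V \<and> (\<forall>u\<in>V. \<exists>c. \<forall>x\<in>X. u x = (\<Sum>g\<in>G. c g * g x))"
      by (intro insert.IH insert.prems) auto
    then obtain G where G: "finite G" "G \<subseteq> V" "\<forall>u\<in>V. \<exists>c. \<forall>x\<in>X. u x = (\<Sum>g\<in>G. c g * g x)"
      by blast
    have "(\<Sum>g\<in>G. c g * g x) = 0" for c using G(2) False by (intro sum.neutral) auto
    thus ?thesis using G False by (intro exI[of _ G]) fastforce
  qed
qed

lemma mat_mult_component: "(mat c ** X) $ i $ j = c * X $ i $ j"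
  by (simp add: matrix_matrix_mult_def mat_def if_distrib[of "\<lambda>c. c * _"] cong: if_cong)

lemma mult_mat_component: "(X ** mat c) $ i $ j = c * (X::'k::comm_ring_1^'n^'m) $ i $ j"
  by (simp add: matrix_matrix_mult_def mat_def if_distrib[of "\<lambda>c. _ * c"] mult.commute cong: if_cong)

lemma mult_mat_commute: "X ** mat c = mat c ** (X::'k::comm_ring_1^'n^'n)"
  by (simp add: vec_eq_iff mat_mult_component mult_mat_component)

lemma mat_add: "mat (a + b) = mat a + mat (b :: 'k::comm_ring_1)"
  by (simp add: vec_eq_iff mat_def)

lemma matrix_mult_add_left: "(A + B) ** C = A ** C + B ** (C :: 'k::comm_ring_1^'n^'m)"
  by (simp add: vec_eq_iff matrix_matrix_mult_def distrib_right sum.distrib)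

lemma mat_mult: "mat a ** mat b = mat (a * b)"
  by (simp add: vec_eq_iff mat_mult_component) (simp add: mat_def)

text \<open>
  The value of a polynomial at a square matrix, by Horner's scheme.
\<close>

definition mat_poly :: "'k::comm_ring_1^'n^'n \<Rightarrow> 'k poly \<Rightarrow> 'k^'n^'n" where
  "mat_poly A p = fold_coeffs (\<lambda>c X. mat c + A ** X) p 0"

lemma mat_poly_0 [simp]: "mat_poly A 0 = 0"
  by (simp add: mat_poly_def)

lemma mat_poly_pCons [simp]: "mat_poly A (pCons c p) = mat c + A ** mat_poly A p"
  by (cases "c = 0 \<and> p = 0") (auto simp: mat_poly_def)

lemma mat_poly_add: "mat_poly A (p + q) = mat_poly A p + mat_poly A q"
  by (induction p q rule: poly_induct2) (simp_all add: mat_add matrix_add_ldistrib)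

lemma mat_poly_smult: "mat_poly A (smult c p) = mat c ** mat_poly A p"
proof (induction p)
  case (pCons a p)
  have "A ** (mat c ** mat_poly A p) = mat c ** (A ** mat_poly A p)"
    by (simp add: matrix_mul_assoc mult_mat_commute)
  thus ?case using pCons by (simp add: mat_mult matrix_add_ldistrib)
qed simp

lemma mat_poly_mult: "mat_poly A (p * q) = mat_poly A p ** mat_poly A q"
  by (induction p) (simp_all add: mat_poly_add mat_poly_smult matrix_mult_add_left matrix_mul_assoc)

lemma mat_poly_commute: "A ** mat_poly A p = mat_poly A p ** A"
proof -
  have "mat_poly A ([:0, 1:] * p) = mat_poly A (p * [:0, 1:])" by (subst mult.commute) (rule refl)
  thus ?thesis by (simp only: mat_poly_mult) simp
qed

lemma mat_poly_minus: "mat_poly A (p - q) = mat_poly A p - mat_poly A q"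
  using mat_poly_add[of A "p - q" q] by simp

lemma mat_poly_sum: "mat_poly A (\<Sum>x\<in>X. p x) = (\<Sum>x\<in>X. mat_poly A (p x))"
  by (induction X rule: infinite_finite_induct) (auto simp: mat_poly_add)

text \<open>
  The matrices \<open>mat_poly A p\<close> have finitely many entries, so finitely many of them span all of them; a power
  of \<open>A\<close> beyond the degrees of the polynomials involved is then a combination of lower powers.
\<close>

lemma annihilating_poly_exists:
  fixes A :: "'k::field^'n^'n"
  shows "\<exists>p. p \<noteq> 0 \<and> mat_poly A p = 0"
proof -
  define \<Phi> where "\<Phi> p = (\<lambda>(i, j). mat_poly A p $ i $ j)" for p
  have lin: "(\<lambda>x. \<Phi> p x + c * \<Phi> q x) = \<Phi> (p + smult c q)" for p q c
    by (auto simp: \<Phi>_def mat_poly_add mat_poly_smult mat_mult_component)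
  have "\<exists>G. finite G \<and> G \<subseteq> range \<Phi> \<and> (\<forall>u\<in>range \<Phi>. \<exists>c. \<forall>x\<in>UNIV. u x = (\<Sum>g\<in>G. c g * g x))"
  proof (rule finite_spanning_set)
    fix u w :: "'n \<times> 'n \<Rightarrow> 'k" and c
    assume "u \<in> range \<Phi>" "w \<in> range \<Phi>"
    then obtain p q where "u = \<Phi> p" "w = \<Phi> q" by blast
    thus "(\<lambda>x. u x + c * w x) \<in> range \<Phi>" using lin[of p c q] by (metis rangeI)
  qed auto
  then obtain G where G: "finite G" "G \<subseteq> range \<Phi>"
    and span: "\<forall>u\<in>range \<Phi>. \<exists>c. \<forall>x\<in>UNIV. u x = (\<Sum>g\<in>G. c g * g x)"
    by (elim exE conjE) (rule that)
  have "\<forall>g\<in>G. \<exists>p. g = \<Phi> p" using G(2) by blast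
  then obtain P where P: "\<forall>g\<in>G. g = \<Phi> (P g)" by (rule bchoice[THEN exE])
  define N where "N = Suc (\<Sum>g\<in>G. degree (P g))"
  have N: "degree (P g) < N" if "g \<in> G" for g
    using member_le_sum[of g G "\<lambda>g. degree (P g)"] that G(1) by (simp add: N_def)
  obtain c where c: "\<forall>x\<in>UNIV. \<Phi> (monom 1 N) x = (\<Sum>g\<in>G. c g * g x)"
    using bspec[OF span rangeI[of \<Phi> "monom 1 N"]] by (elim exE) (rule that)
  define p where "p = monom 1 N - (\<Sum>g\<in>G. smult (c g) (P g))"
  have "coeff (P g) N = 0" if "g \<in> G" for g using N[OF that] by (rule coeff_eq_0)
  hence "coeff p N = 1" by (simp add: p_def coeff_sum)
  moreover have "mat_poly A p $ i $ j = 0" for i j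
  proof -
    have "(\<Sum>g\<in>G. c g * g (i, j)) = (\<Sum>g\<in>G. c g * mat_poly A (P g) $ i $ j)"
    proof (rule sum.cong[OF refl])
      fix g assume "g \<in> G"
      hence "g = \<Phi> (P g)" using P by blast
      hence "g (i, j) = \<Phi> (P g) (i, j)" by (rule arg_cong)
      thus "c g * g (i, j) = c g * mat_poly A (P g) $ i $ j" by (simp add: \<Phi>_def)
    qed
    thus ?thesis using bspec[OF c UNIV_I, of "(i, j)"]
      by (simp add: \<Phi>_def p_def mat_poly_minus mat_poly_sum mat_poly_smult mat_mult_component)
  qed
  ultimately show ?thesis by (intro exI[of _ p]) (auto simp: vec_eq_iff)
qed

text \<open>
  Let \<open>\<mu> = (x - a) q\<close> be the minimal polynomial of \<open>A\<close>; it is not linear because \<open>A\<close> is not scalar. If \<open>q(a) = 0\<close>,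
  then \<open>\<mu>\<close> divides \<open>q\<^sup>2\<close>, so \<open>q(A)\<close> has square zero. Otherwise \<open>\<mu>\<close> divides \<open>q (q - q(a))\<close>, so \<open>q(A) / q(a)\<close> is
  idempotent. By minimality neither \<open>q(A)\<close> nor \<open>q(A) - q(a)\<close> is zero.
\<close>

lemma idempotent_or_nilpotent_poly:
  fixes A :: "'k::alg_closed_field^'n^'n"
  assumes "A \<notin> range mat"
  shows "\<exists>p. let B = mat_poly A p in
    B \<noteq> 0 \<and> (B ** B = B \<and> B \<noteq> mat 1 \<or> B ** B = 0)"
proof -
  define P where "P p \<longleftrightarrow> p \<noteq> 0 \<and> mat_poly A p = 0" for p
  obtain p\<^sub>0 where "P p\<^sub>0" using annihilating_poly_exists[of A] unfolding P_def by blast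
  from ex_has_least_nat[of P, OF this, of degree]
  obtain \<mu> where \<mu>: "P \<mu>" and min: "\<And>p. P p \<Longrightarrow> degree \<mu> \<le> degree p" by blast
  have small: "mat_poly A p \<noteq> 0" if "p \<noteq> 0" "degree p < degree \<mu>" for p
    using min[of p] that by (auto simp: P_def)
  have mat0: "c = 0" if "mat c = (0 :: 'k^'n^'n)" for c
  proof -
    have "(mat c :: 'k^'n^'n) $ undefined $ undefined = 0" using that by simp
    thus ?thesis by (simp add: mat_def)
  qed
  have "degree \<mu> \<noteq> 0"
  proof
    assume "degree \<mu> = 0"
    then obtain c where "\<mu> = [:c:]" by (rule degree_eq_zeroE)
    thus False using \<mu> mat0[of c] by (auto simp: P_def)
  qed
  then obtain a where "poly \<mu> a = 0" using alg_closed_imp_poly_has_root by blast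
  then obtain q where q: "\<mu> = [:- a, 1:] * q" by (auto simp: poly_eq_0_iff_dvd)
  have q0: "q \<noteq> 0" using \<mu> q by (auto simp: P_def)
  hence deg: "degree \<mu> = Suc (degree q)" using q by (simp add: degree_mult_eq del: mult_pCons_left)
  have degq: "degree q \<noteq> 0"
  proof
    assume "degree q = 0"
    then obtain c where c: "q = [:c:]" by (rule degree_eq_zeroE)
    hence c0: "c \<noteq> 0" using q0 by auto
    have "\<mu> = smult c [:- a, 1:]" using q c by simp
    hence "mat c ** (mat (- a) + A) = 0" using \<mu> by (simp add: P_def mat_poly_smult del: smult_pCons)
    hence "A = mat a" using c0
      by (auto simp: vec_eq_iff mat_mult_component) (auto simp: mat_def add_eq_0_iff split: if_splits)
    thus False using assms by blast
  qed
  have mul0: "mat_poly A (s * \<mu>) = 0" for s using \<mu> by (simp add: P_def mat_poly_mult)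
  show ?thesis
  proof (cases "poly q a = 0")
    case True
    then obtain s where s: "q = [:- a, 1:] * s" by (auto simp: poly_eq_0_iff_dvd)
    have "q * q = s * \<mu>" using q s by (metis mult.assoc mult.commute)
    hence "mat_poly A q ** mat_poly A q = 0" using mul0 by (metis mat_poly_mult)
    thus ?thesis using small[OF q0] deg by (intro exI[of _ q]) (simp add: Let_def)
  next
    case False
    define b where "b = poly q a"
    have b: "b \<noteq> 0" using False by (simp add: b_def)
    have "poly (q - [:b:]) a = 0" by (simp add: b_def)
    then obtain s where s: "q - [:b:] = [:- a, 1:] * s" unfolding poly_eq_0_iff_dvd by (rule dvdE)
    define p where "p = smult (1 / b) q"
    have "p * p - p = smult (1 / b / b) (q * (q - [:b:]))"
      using b by (simp add: p_def algebra_simps smult_diff_right)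
    also have "q * (q - [:b:]) = s * \<mu>" unfolding s q by (simp only: mult.assoc mult.commute mult.left_commute)
    finally have "p * p - p = smult (1 / b / b) (s * \<mu>)" .
    hence "mat_poly A (p * p - p) = 0" using mul0[of s] by (simp add: mat_poly_smult)
    hence "mat_poly A p ** mat_poly A p = mat_poly A p"
      by (simp add: mat_poly_minus mat_poly_mult)
    moreover have "mat_poly A p \<noteq> 0"
      by (rule small) (use b q0 deg in \<open>auto simp: p_def\<close>)
    moreover have "mat_poly A (p - 1) \<noteq> 0"
    proof (rule small)
      have "degree p > degree (1 :: 'k poly)" using degq b by (simp add: p_def)
      hence "p \<noteq> 1" by auto
      thus "p - 1 \<noteq> 0" by simp
      have "degree (p - 1) \<le> degree q"
        by (rule degree_diff_le) (simp_all add: p_def)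
      thus "degree (p - 1) < degree \<mu>" using deg by simp
    qed
    hence "mat_poly A p \<noteq> mat 1" by (simp add: mat_poly_minus one_pCons)
    ultimately show ?thesis by (intro exI[of _ p]) (simp add: Let_def)
  qed
qed

lemma generalized_inverse_exists:
  fixes A :: "'k::field^'n^'n"
  obtains S where "A ** S ** A = A"
proof -
  have lin: "Vector_Spaces.linear (*s) (*s) ((*v) A)" by (rule matrix_vector_mul_linear_gen)
  obtain g where g: "Vector_Spaces.linear (*s) (*s) g" "\<And>v. A *v g (A *v v) = A *v v"
    using vec.linear_exists_right_inverse_on[OF lin vec.subspace_UNIV] by auto
  have "A ** matrix g ** A = A"
    unfolding matrix_eq using g matrix_works[OF g(1)] by (simp flip: matrix_vector_mul_assoc)
  thus thesis using that by blast
qed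

section \<open>Matrices that are self-adjoint for a form\<close>

text \<open>
  Contraction with \<open>\<partial>\<^sub>i\<close> shifts the family of coefficients by \<open>var i\<close>. Thus the vector \<open>grad \<phi> \<alpha>\<close> consists of the
  coefficients at \<open>\<alpha>\<close> of the first derivatives, and similarly \<open>hess \<phi> \<alpha>\<close> for the second derivatives.
\<close>

definition grad :: "(('r::finite \<Rightarrow>\<^sub>0 nat) \<Rightarrow> 'k) \<Rightarrow> ('r \<Rightarrow>\<^sub>0 nat) \<Rightarrow> 'k^'r" where
  "grad \<phi> \<alpha> = (\<chi> i. \<phi> (\<alpha> + var i))"

definition hess :: "(('r::finite \<Rightarrow>\<^sub>0 nat) \<Rightarrow> 'k) \<Rightarrow> ('r \<Rightarrow>\<^sub>0 nat) \<Rightarrow> 'k^'r^'r" where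
  "hess \<phi> \<alpha> = (\<chi> i j. \<phi> (\<alpha> + var i + var j))"

definition self_adjoint :: "'k::comm_ring_1^'r^'r \<Rightarrow> (('r::finite \<Rightarrow>\<^sub>0 nat) \<Rightarrow> 'k) \<Rightarrow> bool" where
  "self_adjoint A \<phi> \<longleftrightarrow> (\<forall>\<alpha>. A ** hess \<phi> \<alpha> = hess \<phi> \<alpha> ** transpose A)"

lemma grad_mult_component: "(A *v grad \<phi> \<alpha>) $ i = (\<Sum>a\<in>UNIV. A $ i $ a * \<phi> (\<alpha> + var a))"
  by (simp add: matrix_vector_mult_def grad_def)

lemma self_adjoint_iff_grad:
  "self_adjoint A \<phi> \<longleftrightarrow>
     (\<forall>\<alpha> i j. (A *v grad \<phi> (\<alpha> + var j)) $ i = (A *v grad \<phi> (\<alpha> + var i)) $ j)"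
  by (simp add: self_adjoint_def vec_eq_iff grad_mult_component matrix_matrix_mult_def hess_def
      transpose_def ac_simps)

lemma self_adjoint_mat: "self_adjoint (mat c) \<phi>"
  by (simp add: self_adjoint_def vec_eq_iff mult_mat_component mat_mult_component transpose_mat)

lemma self_adjoint_diff:
  fixes A :: "'k::comm_ring_1^'r^'r"
  shows "self_adjoint A \<phi> \<Longrightarrow> self_adjoint B \<phi> \<Longrightarrow> self_adjoint (A - B) \<phi>"
  by (auto simp: self_adjoint_iff_grad matrix_vector_mult_diff_rdistrib)

text \<open>
  If \<open>B\<close> is self-adjoint and commutes with \<open>A\<close>, then \<open>A B H = A H B\<^sup>T = H A\<^sup>T B\<^sup>T = H (A B)\<^sup>T\<close> for each Hessian \<open>H\<close>.
\<close>

lemma self_adjoint_mat_poly: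
  assumes "self_adjoint A \<phi>"
  shows "self_adjoint (mat_poly A p) \<phi>"
proof (induction p)
  case 0
  thus ?case using self_adjoint_mat[of 0 \<phi>] by simp
next
  case (pCons c p)
  let ?B = "mat_poly A p"
  have "self_adjoint (A ** ?B) \<phi>" unfolding self_adjoint_def
  proof
    fix \<alpha>
    let ?H = "hess \<phi> \<alpha>"
    have "A ** ?B ** ?H = A ** (?H ** transpose ?B)"
      using pCons unfolding self_adjoint_def by (metis matrix_mul_assoc)
    also have "\<dots> = ?H ** (transpose A ** transpose ?B)"
      using assms unfolding self_adjoint_def by (metis matrix_mul_assoc)
    also have "transpose A ** transpose ?B = transpose (A ** ?B)"
      by (subst mat_poly_commute) (simp add: matrix_transpose_mul)
    finally show "A ** ?B ** ?H = ?H ** transpose (A ** ?B)" .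
  qed
  from self_adjoint_diff[OF this self_adjoint_mat[of "- c"]]
  have "self_adjoint (A ** ?B - mat (- c)) \<phi>" .
  moreover have "A ** ?B - mat (- c) = mat_poly A (pCons c p)"
    using mat_add[of c "- c"] by (simp add: algebra_simps eq_neg_iff_add_eq_0)
  ultimately show ?case by simp
qed

lemma self_adjointI_grad:
  assumes "\<And>\<alpha>. grad \<psi> \<alpha> = A *v grad \<phi> \<alpha>"
  shows "self_adjoint A \<phi>"
  unfolding self_adjoint_iff_grad assms[symmetric] by (simp add: grad_def ac_simps)

text \<open>
  The coefficient of \<open>g\<close> at \<open>\<alpha>\<close> can be read off from the \<open>i\<close>-th entry of \<open>A \<nabla>f\<close> for any \<open>i\<close> with \<open>\<alpha>\<^sub>i > 0\<close>.
  Self-adjointness says that all choices of \<open>i\<close> give the same value.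
\<close>

lemma primitive_exists:
  assumes "self_adjoint A (Poly_Mapping.lookup f)" "f \<in> homog UNIV d" "d > 0"
  obtains g where "g \<in> homog UNIV d"
    "\<And>\<alpha>. grad (Poly_Mapping.lookup g) \<alpha> = A *v grad (Poly_Mapping.lookup f) \<alpha>"
proof -
  let ?f = "Poly_Mapping.lookup f"
  define ix where "ix \<alpha> = (SOME i. Poly_Mapping.lookup \<alpha> i > 0)" for \<alpha> :: "'b \<Rightarrow>\<^sub>0 nat"
  define g where "g = form_of d (\<lambda>\<alpha>. (A *v grad ?f (\<alpha> - var (ix \<alpha>))) $ ix \<alpha>)"
  have "g \<in> homog UNIV d" unfolding g_def by (rule form_of_homog) auto
  moreover have "grad (Poly_Mapping.lookup g) \<alpha> $ i = (A *v grad ?f \<alpha>) $ i" for \<alpha> i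
  proof (cases "mdeg (\<alpha> + var i) = d")
    case True
    obtain k where ix: "ix (\<alpha> + var i) = k" by blast
    have "Poly_Mapping.lookup (\<alpha> + var i) i > 0" by (simp add: lookup_add lookup_var)
    hence k: "Poly_Mapping.lookup (\<alpha> + var i) k > 0" unfolding ix[symmetric] ix_def by (rule someI)
    have "(A *v grad ?f (\<alpha> + var i - var k)) $ k = (A *v grad ?f \<alpha>) $ i"
    proof (cases "k = i")
      case False
      hence "Poly_Mapping.lookup \<alpha> k > 0" using k by (simp add: lookup_add lookup_var)
      then obtain \<gamma> where \<gamma>: "\<alpha> = \<gamma> + var k" by (metis diff_var_add)
      have "\<alpha> + var i - var k = \<gamma> + var i"
        using add_diff_cancel_right'[of "\<gamma> + var i" "var k"] by (simp add: \<gamma> ac_simps)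
      thus ?thesis using assms(1) \<gamma> unfolding self_adjoint_iff_grad by metis
    qed simp
    thus ?thesis using True ix by (simp add: grad_def g_def lookup_form_of)
  next
    case False
    hence "?f (\<alpha> + var a) = 0" for a using assms(2) by (simp add: homog_iff)
    hence "(A *v grad ?f \<alpha>) $ i = 0" by (simp add: grad_mult_component)
    thus ?thesis using False by (simp add: grad_def g_def lookup_form_of)
  qed
  ultimately show thesis using that by (simp add: vec_eq_iff)
qed

definition linear_op :: "'k::comm_ring_1^'r \<Rightarrow> ('r::finite \<Rightarrow>\<^sub>0 nat) \<Rightarrow>\<^sub>0 'k" where
  "linear_op b = (\<Sum>a\<in>UNIV. Poly_Mapping.single (var a) (b $ a))"

lemma pairing_linear_op: "pairing (linear_op b) \<phi> = (\<Sum>a\<in>UNIV. b $ a * \<phi> (var a))"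
  by (simp add: linear_op_def pairing_sum)

lemma var_eq_iff [simp]: "var i = var j \<longleftrightarrow> i = j"
  by (metis lookup_var zero_neq_one)

lemma lookup_linear_op_var: "Poly_Mapping.lookup (linear_op b) (var a) = b $ a"
  by (simp add: linear_op_def lookup_sum lookup_single when_def)

lemma linear_op_homog: "linear_op b \<in> homog UNIV 1"
  by (auto simp: homog_iff linear_op_def lookup_sum lookup_single when_def intro!: sum.neutral)

lemma no_linear_annihilatorD:
  assumes "ann f \<inter> homog UNIV 1 = {0}"
    and "\<And>\<alpha>. B *v grad (Poly_Mapping.lookup f) \<alpha> = 0"
  shows "B = 0"
proof -
  have "B $ i = 0" for i
  proof -
    have "contract (linear_op (B $ i)) f = 0"
    proof (rule poly_mapping_eqI)
      fix \<alpha>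
      show "Poly_Mapping.lookup (contract (linear_op (B $ i)) f) \<alpha> = Poly_Mapping.lookup 0 \<alpha>"
        using assms(2)[of \<alpha>]
        by (simp add: lookup_contract pairing_linear_op vec_eq_iff grad_mult_component)
    qed
    hence "linear_op (B $ i) \<in> ann f \<inter> homog UNIV 1" using linear_op_homog[of "B $ i"] by (simp add: ann_def)
    hence "linear_op (B $ i) = 0" using assms(1) by blast
    thus ?thesis by (metis lookup_linear_op_var lookup_zero vec_eq_iff zero_index)
  qed
  thus ?thesis by (simp add: vec_eq_iff)
qed

lemma no_linear_annihilator_nonzero:
  assumes "ann f \<inter> homog UNIV 1 = {0 :: ('r::finite, 'k::comm_ring_1) mpoly}"
  shows "f \<noteq> 0"
proof
  assume "f = 0"
  hence "\<And>\<alpha>. mat 1 *v grad (Poly_Mapping.lookup f) \<alpha> = 0" by (simp add: grad_def vec_eq_iff)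
  from no_linear_annihilatorD[OF assms this] have "(mat 1 :: 'k^'r^'r) $ undefined $ undefined = 0"
    by simp
  thus False by (simp add: mat_def)
qed

lemma grad_contract:
  assumes "\<And>\<alpha>. grad (Poly_Mapping.lookup g) \<alpha> = A *v grad (Poly_Mapping.lookup f) \<alpha>"
  shows "grad (Poly_Mapping.lookup (contract D g)) \<alpha> = A *v grad (Poly_Mapping.lookup (contract D f)) \<alpha>"
proof -
  have "Poly_Mapping.lookup (contract D g) (\<alpha> + var i) =
      (\<Sum>a\<in>UNIV. A $ i $ a * Poly_Mapping.lookup (contract D f) (\<alpha> + var a))" for i
  proof -
    have "Poly_Mapping.lookup g (\<alpha> + var i + \<beta>) =
        (\<Sum>a\<in>UNIV. A $ i $ a * Poly_Mapping.lookup f (\<alpha> + var a + \<beta>))" for \<beta>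
      using arg_cong[OF assms[of "\<alpha> + \<beta>"], of "\<lambda>v. v $ i"]
      by (simp add: grad_mult_component) (simp add: grad_def ac_simps)
    thus ?thesis by (simp add: lookup_contract pairing_linear)
  qed
  thus ?thesis by (simp add: vec_eq_iff grad_mult_component) (simp add: grad_def)
qed

text \<open>
  For \<open>e < d\<close> the contraction \<open>D g\<close> has positive degree, and its derivatives are combinations of those of \<open>D f\<close>.
  This argument breaks down for \<open>e = d\<close>, when both contractions are constants.
\<close>

lemma contract_primitive_eq_0:
  assumes "\<And>\<alpha>. grad (Poly_Mapping.lookup g) \<alpha> = A *v grad (Poly_Mapping.lookup f) \<alpha>"
    and "g \<in> homog L' d" "D \<in> homog L e" "e \<noteq> d" "contract D f = 0"
  shows "contract D g = 0"
proof (rule contract_homog_eq_0[OF assms(3,2)])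
  fix \<alpha> :: "'a \<Rightarrow>\<^sub>0 nat" assume "mdeg \<alpha> + e = d"
  then obtain n where "mdeg \<alpha> = Suc n" using assms(4) by (cases "mdeg \<alpha>") auto
  then obtain i \<beta> where "\<alpha> = \<beta> + var i" by (rule mdeg_SucE)
  thus "Poly_Mapping.lookup (contract D g) \<alpha> = 0"
    using arg_cong[OF grad_contract[OF assms(1), of D \<beta>], of "\<lambda>v. v $ i"] assms(5)
    by (simp add: grad_mult_component) (simp add: grad_def)
qed

text \<open>
  A family \<open>v\<close> in degree \<open>d - 1\<close> outside the span of the derivatives of \<open>F\<close> is separated from them by a functional,
  which is an operator \<open>D\<close> of degree \<open>d - 1\<close>. The contraction \<open>D F\<close> is a linear form whose coefficients are the
  values of the functional at the derivatives of \<open>F\<close>. So it vanishes, although \<open>D\<close> does not vanish at \<open>v\<close>.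
\<close>

lemma partials_span_duality:
  fixes F :: "('r::finite, 'q::field) dpow"
  assumes L: "is_subfield L" and F: "F \<in> homog L d" and "d > 0"
    and v: "\<And>\<alpha>. v \<alpha> \<in> L"
    and orth: "\<And>D. D \<in> homog L (d - 1) \<Longrightarrow> contract D F = 0 \<Longrightarrow> pairing D v = 0"
  shows "\<exists>b::'q^'r. (\<forall>k. b $ k \<in> L) \<and>
    (\<forall>\<alpha>. mdeg \<alpha> = d - 1 \<longrightarrow> v \<alpha> = (\<Sum>k\<in>UNIV. b $ k * Poly_Mapping.lookup F (\<alpha> + var k)))"
proof -
  let ?F = "Poly_Mapping.lookup F"
  define w where "w b \<alpha> = (\<Sum>k\<in>UNIV. b $ k * ?F (\<alpha> + var k))" for b :: "'q^'r" and \<alpha>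
  define V where "V = {w b | b. \<forall>k. b $ k \<in> L}"
  let ?X = "{\<alpha> :: 'r \<Rightarrow>\<^sub>0 nat. mdeg \<alpha> = d - 1}"
  have FL: "?F \<alpha> \<in> L" for \<alpha> using F by (simp add: homog_iff)
  have "\<exists>u\<in>V. \<forall>\<alpha>\<in>?X. u \<alpha> = v \<alpha>"
  proof (rule ccontr)
    assume no: "\<not> (\<exists>u\<in>V. \<forall>\<alpha>\<in>?X. u \<alpha> = v \<alpha>)"
    have "(\<lambda>\<alpha>. u \<alpha> + c * u' \<alpha>) \<in> V" if uu: "u \<in> V" "u' \<in> V" and c: "c \<in> L" for u u' c
    proof -
      obtain b b' where b: "u = w b" "u' = w b'" "\<forall>k. b $ k \<in> L" "\<forall>k. b' $ k \<in> L"
        using uu unfolding V_def by blast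
      have "(\<lambda>\<alpha>. u \<alpha> + c * u' \<alpha>) = w (b + c *s b')"
        by (auto simp: b w_def algebra_simps sum.distrib sum_distrib_left)
      moreover have "\<forall>k. (b + c *s b') $ k \<in> L" using b c by (simp add: is_subfieldD[OF L])
      ultimately show ?thesis unfolding V_def by blast
    qed
    moreover have "w 0 \<in> V" unfolding V_def using is_subfieldD[OF L] by force
    hence "V \<noteq> {}" by blast
    moreover have "u \<alpha> \<in> L" if "u \<in> V" for u \<alpha>
      using that FL by (auto simp: V_def w_def is_subfieldD[OF L] intro!: is_subfield_sum[OF L])
    ultimately have "\<exists>g. (\<forall>x. g x \<in> L) \<and> (\<forall>u\<in>V. (\<Sum>x\<in>?X. g x * u x) = 0) \<and> (\<Sum>x\<in>?X. g x * v x) \<noteq> 0"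
      using no v by (intro separating_functional[OF finite_mdeg L]) auto
    then obtain g where g: "\<And>x. g x \<in> L" "\<And>u. u \<in> V \<Longrightarrow> (\<Sum>x\<in>?X. g x * u x) = 0"
      "(\<Sum>x\<in>?X. g x * v x) \<noteq> 0" by blast
    define D where "D = form_of (d - 1) g"
    have D: "D \<in> homog L (d - 1)" unfolding D_def using g(1) is_subfieldD[OF L]
      by (intro form_of_homog) auto
    have pD: "pairing D \<phi> = (\<Sum>x\<in>?X. g x * \<phi> x)" for \<phi>
      unfolding pairing_homog[OF D] by (rule sum.cong) (auto simp: D_def lookup_form_of)
    have "contract D F = 0"
    proof (rule contract_homog_eq_0[OF D F])
        fix \<alpha> :: "'r \<Rightarrow>\<^sub>0 nat" assume "mdeg \<alpha> + (d - 1) = d"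
        hence "mdeg \<alpha> = Suc 0" using \<open>d > 0\<close> by simp
        then obtain k \<beta> where k: "\<alpha> = \<beta> + var k" "mdeg \<beta> = 0" by (rule mdeg_SucE)
        have "w (axis k 1) \<in> V" unfolding V_def using is_subfieldD[OF L] by (force simp: axis_def)
        from g(2)[OF this] show "Poly_Mapping.lookup (contract D F) \<alpha> = 0"
          using k by (simp add: lookup_contract pD w_def axis_def if_distrib[of "\<lambda>c. c * _"]
              add.commute cong: if_cong)
      qed
    from orth[OF D this] show False using g(3) by (simp add: pD)
  qed
  then obtain b where "\<forall>k. b $ k \<in> L" "\<forall>\<alpha>\<in>?X. w b \<alpha> = v \<alpha>" by (auto simp: V_def)
  thus ?thesis by (intro exI[of _ b]) (auto simp: w_def)
qed

lemma pairing_shift_var: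
  assumes "mdeg \<alpha> = 1"
  obtains a where "Poly_Mapping.lookup (contract D g) \<alpha> = pairing D (\<lambda>\<beta>. Poly_Mapping.lookup g (\<beta> + var a))"
proof -
  have "mdeg \<alpha> = Suc 0" using assms by simp
  then obtain a \<beta> where "\<alpha> = \<beta> + var a" "mdeg \<beta> = 0" by (rule mdeg_SucE)
  thus thesis using that[of a] by (simp add: lookup_contract add.commute)
qed

lemma grad_in_span_duality:
  fixes F g :: "('r::finite, 'q::field) dpow"
  assumes L: "is_subfield L" and F: "F \<in> homog L d" and g: "g \<in> homog L d" and "d > 0"
    and orth: "\<And>D. D \<in> homog L (d - 1) \<Longrightarrow> contract D F = 0 \<Longrightarrow> contract D g = 0"
  obtains A where "\<And>i j. A $ i $ j \<in> L"
    "\<And>\<alpha>. grad (Poly_Mapping.lookup g) \<alpha> = A *v grad (Poly_Mapping.lookup F) \<alpha>"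
proof -
  have "\<exists>b::'q^'r. (\<forall>k. b $ k \<in> L) \<and> (\<forall>\<alpha>. mdeg \<alpha> = d - 1 \<longrightarrow>
      Poly_Mapping.lookup g (\<alpha> + var i) = (\<Sum>k\<in>UNIV. b $ k * Poly_Mapping.lookup F (\<alpha> + var k)))" for i
  proof (rule partials_span_duality[OF L F \<open>d > 0\<close>])
    show "Poly_Mapping.lookup g (\<alpha> + var i) \<in> L" for \<alpha> using g by (simp add: homog_iff)
    fix D :: "('r, 'q) mpoly" assume "D \<in> homog L (d - 1)" "contract D F = 0"
    from orth[OF this] have "Poly_Mapping.lookup (contract D g) (var i) = 0" by simp
    thus "pairing D (\<lambda>\<alpha>. Poly_Mapping.lookup g (\<alpha> + var i)) = 0"
      by (simp add: lookup_contract add.commute)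
  qed
  then obtain B :: "'r \<Rightarrow> 'q^'r" where B: "\<And>i k. B i $ k \<in> L"
    "\<And>i \<alpha>. mdeg \<alpha> = d - 1 \<Longrightarrow>
      Poly_Mapping.lookup g (\<alpha> + var i) = (\<Sum>k\<in>UNIV. B i $ k * Poly_Mapping.lookup F (\<alpha> + var k))"
    by metis
  have "Poly_Mapping.lookup g (\<alpha> + var i) = (\<Sum>k\<in>UNIV. B i $ k * Poly_Mapping.lookup F (\<alpha> + var k))" for i \<alpha>
  proof (cases "mdeg \<alpha> = d - 1")
    case False
    hence "mdeg (\<alpha> + var k) \<noteq> d" for k using \<open>d > 0\<close> by simp
    thus ?thesis using F g by (simp add: homog_iff)
  qed (rule B)
  hence "grad (Poly_Mapping.lookup g) \<alpha> = (\<chi> i. B i) *v grad (Poly_Mapping.lookup F) \<alpha>" for \<alpha>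
    by (simp add: vec_eq_iff grad_mult_component) (simp add: grad_def)
  thus thesis using B(1) by (intro that[of "\<chi> i. B i"]) simp_all
qed

section \<open>Generators of the annihilator in the degree of the form\<close>

interpretation ideal: module "(*) :: 'a::comm_ring_1 \<Rightarrow> 'a \<Rightarrow> 'a"
  by unfold_locales (simp_all add: algebra_simps)

lemma ideal_span_delete_0: "ideal.span (G - {0}) = ideal.span (G :: 'a::comm_ring_1 set)"
proof
  have "x \<in> ideal.span (G - {0})" if "x \<in> G" for x
    using that by (cases "x = 0") (simp_all add: ideal.span_zero ideal.span_base)
  thus "ideal.span G \<subseteq> ideal.span (G - {0})"
    by (intro ideal.span_minimal ideal.subspace_span) blast
qed (simp add: ideal.span_mono)

lemma ann_subspace: "ideal.subspace (ann f)"
  by (auto simp: ideal.subspace_def ann_def contract_add_left contract_mult)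

lemma form_of_homog_UNIV: "form_of e \<phi> \<in> homog UNIV e"
  by (simp add: homog_iff lookup_form_of when_def)

lemma ann_component:
  assumes "D \<in> ann f" "f \<in> homog L d"
  shows "form_of e (Poly_Mapping.lookup D) \<in> ann f"
proof -
  have "contract (form_of e (Poly_Mapping.lookup D)) f = 0"
  proof (rule contract_homog_eq_0[OF form_of_homog_UNIV assms(2)])
    fix \<alpha> :: "'a \<Rightarrow>\<^sub>0 nat" assume \<alpha>: "mdeg \<alpha> + e = d"
    let ?S = "Poly_Mapping.keys D \<union> {\<beta>. mdeg \<beta> = e}"
    let ?t = "\<lambda>\<beta>. Poly_Mapping.lookup D \<beta> * Poly_Mapping.lookup f (\<alpha> + \<beta>)"
    have "Poly_Mapping.lookup (contract (form_of e (Poly_Mapping.lookup D)) f) \<alpha> = (\<Sum>\<beta> | mdeg \<beta> = e. ?t \<beta>)"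
      unfolding lookup_contract pairing_homog[OF form_of_homog_UNIV]
      by (rule sum.cong) (simp_all add: lookup_form_of)
    also have "\<dots> = (\<Sum>\<beta>\<in>?S. ?t \<beta>)"
      by (rule sum.mono_neutral_left) (use assms(2) \<alpha> in \<open>auto simp: homog_iff\<close>)
    also have "\<dots> = Poly_Mapping.lookup (contract D f) \<alpha>"
      unfolding lookup_contract by (rule pairing_superset[symmetric]) auto
    finally show "Poly_Mapping.lookup (contract (form_of e (Poly_Mapping.lookup D)) f) \<alpha> = 0"
      using assms(1) by (simp add: ann_def)
  qed
  thus ?thesis by (simp add: ann_def)
qed

lemma sum_of_components: "\<exists>N. D = (\<Sum>e<N. form_of e (Poly_Mapping.lookup D))"
proof -
  obtain N where N: "\<forall>x\<in>mdeg ` Poly_Mapping.keys D. x < N"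
    using finite_nat_set_iff_bounded[of "mdeg ` Poly_Mapping.keys D"] by auto
  have "Poly_Mapping.lookup D \<alpha> = (\<Sum>e<N. Poly_Mapping.lookup D \<alpha> when mdeg \<alpha> = e)" for \<alpha>
    using N by (cases "\<alpha> \<in> Poly_Mapping.keys D") (auto simp: when_def in_keys_iff)
  thus ?thesis
    by (intro exI[of _ N] poly_mapping_eqI) (simp add: lookup_sum lookup_form_of)
qed

lemma lookup_const_mult: "Poly_Mapping.lookup (Poly_Mapping.single 0 c * D) \<beta> = (c::'k::comm_ring_1) * Poly_Mapping.lookup D \<beta>"
  unfolding mult_map_scale_conv_mult[symmetric] by (simp add: map.rep_eq when_def)

lemma ann_degree_spanning_set:
  fixes f :: "('r::finite, 'k::field) dpow"
  shows "\<exists>G. finite G \<and> G \<subseteq> ann f \<inter> homog UNIV e \<and> ann f \<inter> homog UNIV e \<subseteq> ideal.span G"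
proof -
  let ?S = "ann f \<inter> homog UNIV e :: ('r, 'k) mpoly set"
  let ?V = "Poly_Mapping.lookup ` ?S"
  have "(\<lambda>x. u x + c * w x) \<in> ?V" if uw: "u \<in> ?V" "w \<in> ?V" for u w c
  proof -
    obtain D E where DE: "u = Poly_Mapping.lookup D" "w = Poly_Mapping.lookup E" "D \<in> ?S" "E \<in> ?S"
      using uw by blast
    have "D + Poly_Mapping.single 0 c * E \<in> ?S"
      using DE ideal.subspace_add[OF ann_subspace, of D f] ideal.subspace_scale[OF ann_subspace, of E f]
      by (auto simp: homog_iff lookup_add lookup_const_mult)
    hence "Poly_Mapping.lookup (D + Poly_Mapping.single 0 c * E) \<in> ?V" by (rule imageI)
    also have "Poly_Mapping.lookup (D + Poly_Mapping.single 0 c * E) = (\<lambda>x. u x + c * w x)"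
      by (rule ext) (simp add: DE(1,2) lookup_add lookup_const_mult)
    finally show ?thesis .
  qed
  moreover have "0 \<in> ?S" using ideal.subspace_0[OF ann_subspace] by (simp add: homog_iff)
  hence "?V \<noteq> {}" by blast
  ultimately have "\<exists>G. finite G \<and> G \<subseteq> ?V \<and> (\<forall>u\<in>?V. \<exists>c. \<forall>x\<in>{\<beta>. mdeg \<beta> = e}. u x = (\<Sum>g\<in>G. c g * g x))"
    by (intro finite_spanning_set) simp_all
  then obtain G where G: "finite G" "G \<subseteq> ?V"
    and span: "\<forall>u\<in>?V. \<exists>c. \<forall>x\<in>{\<beta>. mdeg \<beta> = e}. u x = (\<Sum>g\<in>G. c g * g x)"
    by (elim exE conjE) (rule that)
  obtain H where H: "H \<subseteq> ?S" "finite H" "G = Poly_Mapping.lookup ` H"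
    using finite_subset_image[OF G] by blast
  have inj: "inj_on Poly_Mapping.lookup H" by (intro inj_onI poly_mapping_eqI) simp
  have "D \<in> ideal.span H" if D: "D \<in> ?S" for D
  proof -
    obtain c where c: "\<forall>x\<in>{\<beta>. mdeg \<beta> = e}. Poly_Mapping.lookup D x = (\<Sum>g\<in>G. c g * g x)"
      using bspec[OF span imageI[OF D]] by (elim exE) (rule that)
    let ?E = "\<Sum>h\<in>H. Poly_Mapping.single 0 (c (Poly_Mapping.lookup h)) * h"
    have "D = ?E"
    proof (rule homog_eqI)
      show "D \<in> homog UNIV e" using D by blast
      show "?E \<in> homog UNIV e" using H(1)
        by (auto simp: homog_iff lookup_sum lookup_const_mult intro!: sum.neutral)
      fix \<alpha> :: "'r \<Rightarrow>\<^sub>0 nat" assume "mdeg \<alpha> = e"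
      thus "Poly_Mapping.lookup D \<alpha> = Poly_Mapping.lookup ?E \<alpha>"
        using c by (simp add: lookup_sum lookup_const_mult H(3) sum.reindex[OF inj])
    qed
    also have "?E \<in> ideal.span H"
      by (intro ideal.span_sum ideal.span_scale ideal.span_base)
    finally show ?thesis .
  qed
  thus ?thesis using H by blast
qed

lemma high_degree_in_monomial_ideal:
  assumes "D \<in> homog UNIV e" "n \<le> e"
  shows "D \<in> ideal.span {Poly_Mapping.single \<gamma> (1::'k::comm_ring_1) | \<gamma>. mdeg \<gamma> = n}" (is "_ \<in> ideal.span ?M")
proof -
  have "Poly_Mapping.single \<beta> (Poly_Mapping.lookup D \<beta>) \<in> ideal.span ?M"
    if "\<beta> \<in> Poly_Mapping.keys D" for \<beta>
  proof -
    have "mdeg \<beta> = e" using that assms(1) by (auto simp: in_keys_iff homog_iff)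
    then obtain \<delta> \<gamma> where "\<beta> = \<delta> + \<gamma>" "mdeg \<gamma> = n" using assms(2) monomial_factor by metis
    thus ?thesis
      using ideal.span_scale[OF ideal.span_base[of "Poly_Mapping.single \<gamma> 1" ?M],
          of "Poly_Mapping.single \<delta> (Poly_Mapping.lookup D \<beta>)"]
      by (auto simp: mult_single)
  qed
  hence "(\<Sum>\<beta>\<in>Poly_Mapping.keys D. Poly_Mapping.single \<beta> (Poly_Mapping.lookup D \<beta>)) \<in> ideal.span ?M"
    by (rule ideal.span_sum)
  thus ?thesis by (simp flip: poly_mapping_sum_single)
qed

lemma high_degree_in_ann:
  assumes "D \<in> homog UNIV e" "f \<in> homog L d" "d < e"
  shows "D \<in> ann f"
  using contract_homog_eq_0[OF assms(1,2)] assms(3) by (simp add: ann_def)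

lemma ann_spanned:
  fixes f :: "('r::finite, 'k::field) dpow"
  assumes f: "f \<in> homog UNIV d"
    and G: "G \<subseteq> ann f" "{Poly_Mapping.single \<gamma> 1 | \<gamma>. mdeg \<gamma> = Suc d} \<subseteq> G"
    and low: "\<And>e. e \<le> d \<Longrightarrow> ann f \<inter> homog UNIV e \<subseteq> ideal.span G"
  shows "ideal.span G = ann f"
proof
  show "ideal.span G \<subseteq> ann f" using G(1) ann_subspace by (rule ideal.span_minimal)
  show "ann f \<subseteq> ideal.span G"
  proof
    fix D assume D: "D \<in> ann f"
    obtain N where N: "D = (\<Sum>e<N. form_of e (Poly_Mapping.lookup D))" using sum_of_components by blast
    have "form_of e (Poly_Mapping.lookup D) \<in> ideal.span G" for e
    proof (cases "e \<le> d")
      case True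
      thus ?thesis using low[OF True] ann_component[OF D f] form_of_homog_UNIV by blast
    next
      case False
      hence "form_of e (Poly_Mapping.lookup D) \<in>
          ideal.span {Poly_Mapping.single \<gamma> 1 | \<gamma>. mdeg \<gamma> = Suc d}"
        by (intro high_degree_in_monomial_ideal[OF form_of_homog_UNIV]) simp
      thus ?thesis using ideal.span_mono[OF G(2)] by blast
    qed
    thus "D \<in> ideal.span G" by (subst N) (rule ideal.span_sum)
  qed
qed

lemma finite_degree_monomials: "finite {Poly_Mapping.single \<gamma> (1::'k::comm_ring_1) | \<gamma> :: 'r::finite \<Rightarrow>\<^sub>0 nat. mdeg \<gamma> = n}"
  unfolding Setcompr_eq_image by simp

lemma single_homog: "mdeg \<beta> = e \<Longrightarrow> Poly_Mapping.single \<beta> c \<in> homog UNIV e"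
  by (auto simp: homog_iff lookup_single when_def)

text \<open>
  The annihilator of a form of degree \<open>d\<close> contains every monomial of degree \<open>d + 1\<close>, so it is
  generated by these and by spanning sets of its finitely many lower graded pieces; hence the
  minimum in the definition of \<open>min_num_gens\<close> is taken over a nonempty set. A piece of degree at most \<open>d\<close>
  that lies in the ideal generated by the remaining ones can be left out.
\<close>

lemma generating_set_in_degrees:
  fixes f :: "('r::finite, 'k::field) dpow"
  assumes f: "f \<in> homog UNIV d" and I: "I \<subseteq> {..d}"
    and low: "\<And>e. e \<le> d \<Longrightarrow> ann f \<inter> homog UNIV e \<subseteq> ideal.span (\<Union>i\<in>I. ann f \<inter> homog UNIV i)"
  obtains G where "finite G" "G \<subseteq> (\<Union>e\<in>insert (Suc d) I. homog UNIV e) - {0}" "ideal.span G = ann f"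
proof -
  obtain H where H: "\<And>e. finite (H e)" "\<And>e. H e \<subseteq> ann f \<inter> homog UNIV e"
      "\<And>e. ann f \<inter> homog UNIV e \<subseteq> ideal.span (H e)"
    using ann_degree_spanning_set[of f] by metis
  let ?M = "{Poly_Mapping.single \<gamma> (1::'k) | \<gamma> :: 'r \<Rightarrow>\<^sub>0 nat. mdeg \<gamma> = Suc d}"
  let ?G = "(\<Union>e\<in>I. H e) \<union> ?M"
  have M: "?M \<subseteq> homog UNIV (Suc d)" by (auto simp: single_homog)
  have sub: "ideal.span (\<Union>i\<in>I. ann f \<inter> homog UNIV i) \<subseteq> ideal.span ?G"
  proof (rule ideal.span_minimal)
    show "(\<Union>i\<in>I. ann f \<inter> homog UNIV i) \<subseteq> ideal.span ?G"
    proof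
      fix D assume "D \<in> (\<Union>i\<in>I. ann f \<inter> homog UNIV i)"
      then obtain i where "i \<in> I" "D \<in> ideal.span (H i)" using H(3) by blast
      thus "D \<in> ideal.span ?G" using ideal.span_mono[of "H i" ?G] by blast
    qed
  qed (rule ideal.subspace_span)
  have "ideal.span ?G = ann f"
  proof (rule ann_spanned[OF f])
    show "?G \<subseteq> ann f" using H(2) M high_degree_in_ann[OF _ f, of _ "Suc d"] by blast
    show "ann f \<inter> homog UNIV e \<subseteq> ideal.span ?G" if "e \<le> d" for e using low[OF that] sub by blast
  qed blast
  hence spans: "ideal.span (?G - {0}) = ann f" by (simp only: ideal_span_delete_0)
  have finite: "finite (?G - {0})"
    by (intro finite_Diff finite_UnI finite_UN_I finite_degree_monomials H(1) finite_subset[OF I]) simp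
  have "?G - {0} \<subseteq> (\<Union>e\<in>insert (Suc d) I. homog UNIV e) - {0}" using H(2) M by blast
  thus thesis by (rule that[OF finite _ spans])
qed

lemma homog_inter_zero: "D \<in> homog L e \<Longrightarrow> D \<in> homog L' e' \<Longrightarrow> e \<noteq> e' \<Longrightarrow> D = 0"
  by (rule poly_mapping_eqI) (auto simp: homog_def)

lemma min_num_gens_eq_0_iff:
  fixes f :: "('r::finite, 'k::field) dpow"
  assumes f: "f \<in> homog UNIV d"
  shows "min_num_gens (ann f) d = 0 \<longleftrightarrow>
    (\<exists>G. finite G \<and> G \<subseteq> (\<Union>e. homog UNIV e) - {0} \<and> ideal.span G = ann f \<and> G \<inter> homog UNIV d = {})"
proof -
  define P where "P c \<longleftrightarrow> (\<exists>G. finite G \<and> G \<subseteq> (\<Union>e. homog UNIV e) - {0} \<and> ideal.span G = ann f \<and>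
     c = card (G \<inter> homog UNIV d))" for c
  have min: "min_num_gens (ann f) d = (LEAST c. P c)"
    unfolding P_def min_num_gens_def by (rule refl)
  obtain G where G: "finite G" "G \<subseteq> (\<Union>e\<in>insert (Suc d) {..d}. homog UNIV e) - {0}" "ideal.span G = ann f"
  proof (rule generating_set_in_degrees[OF f order_refl])
    fix e assume "e \<le> d"
    thus "ann f \<inter> homog UNIV e \<subseteq> ideal.span (\<Union>i\<in>{..d}. ann f \<inter> homog UNIV i)"
      by (intro subset_trans[OF _ ideal.span_superset]) auto
  qed
  have "G \<subseteq> (\<Union>e. homog UNIV e) - {0}" using G(2) by auto
  hence "P (card (G \<inter> homog UNIV d))" unfolding P_def using G(1,3) by (intro exI[of _ G]) simp
  hence "P (LEAST c. P c)" by (rule LeastI)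
  hence "(LEAST c. P c) = 0 \<longleftrightarrow> P 0" by (auto intro: Least_eq_0)
  also have "P 0 \<longleftrightarrow> (\<exists>G. finite G \<and> G \<subseteq> (\<Union>e. homog UNIV e) - {0} \<and> ideal.span G = ann f \<and> G \<inter> homog UNIV d = {})"
    unfolding P_def by (intro iff_exI) (auto simp: card_eq_0_iff)
  finally show ?thesis unfolding min .
qed

text \<open>
  The operators \<open>f\<^sub>\<alpha> \<partial>\<^sup>\<beta> - f\<^sub>\<beta> \<partial>\<^sup>\<alpha>\<close> of degree \<open>d\<close> kill \<open>f\<close>, and they kill \<open>g\<close> only if the coefficients of \<open>g\<close> are
  proportional to those of \<open>f\<close>.
\<close>

lemma multiple_of_form:
  fixes f g :: "('r::finite, 'k::field) dpow"
  assumes "f \<in> homog UNIV d" "f \<noteq> 0" "g \<in> homog UNIV d"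
    and kill: "ann f \<inter> homog UNIV d \<subseteq> ann g"
  obtains c where "\<And>\<alpha>. Poly_Mapping.lookup g \<alpha> = c * Poly_Mapping.lookup f \<alpha>"
proof -
  let ?f = "Poly_Mapping.lookup f" and ?g = "Poly_Mapping.lookup g"
  obtain \<alpha> where \<alpha>: "?f \<alpha> \<noteq> 0" using assms(2) by (metis poly_mapping_eqI lookup_zero)
  hence da: "mdeg \<alpha> = d" using assms(1) by (auto simp: homog_iff)
  have "?g \<beta> = (?g \<alpha> / ?f \<alpha>) * ?f \<beta>" for \<beta>
  proof (cases "mdeg \<beta> = d")
    case True
    define D where "D = Poly_Mapping.single \<beta> (?f \<alpha>) + Poly_Mapping.single \<alpha> (- ?f \<beta>)"
    have D: "D \<in> homog UNIV d"
      using True da by (auto simp: D_def homog_iff lookup_add lookup_single when_def)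
    have "contract D f = 0"
      by (rule contract_homog_eq_0[OF D assms(1)])
        (simp add: lookup_contract D_def pairing_add mult.commute)
    hence "contract D g = 0" using kill D by (auto simp: ann_def)
    hence "Poly_Mapping.lookup (contract D g) 0 = 0" by simp
    thus ?thesis using \<alpha> by (simp add: lookup_contract D_def pairing_add field_simps)
  next
    case False
    thus ?thesis using assms(1,3) by (simp add: homog_iff)
  qed
  thus thesis by (rule that)
qed

text \<open>
  Let \<open>g\<close> be the form with \<open>\<nabla>g = A \<nabla>f\<close>. Elements of the annihilator of \<open>f\<close> in degrees other than \<open>d\<close> kill
  \<open>g\<close> as well. If they generated the annihilator, \<open>g\<close> would be killed by everything that kills \<open>f\<close>,
  hence be a multiple of \<open>f\<close>, and \<open>A\<close> would be scalar.
\<close>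

lemma nonscalar_imp_min_num_gens_pos:
  fixes f :: "('r::finite, 'k::field) dpow"
  assumes f: "f \<in> homog UNIV d" "d > 0" and nd: "ann f \<inter> homog UNIV 1 = {0}"
    and A: "self_adjoint A (Poly_Mapping.lookup f)" "A \<notin> range mat"
  shows "min_num_gens (ann f) d > 0"
proof (rule ccontr)
  assume "\<not> min_num_gens (ann f) d > 0"
  then obtain G where G: "G \<subseteq> (\<Union>e. homog UNIV e) - {0}" "ideal.span G = ann f" "G \<inter> homog UNIV d = {}"
    using min_num_gens_eq_0_iff[OF f(1)] by auto
  obtain g where g: "g \<in> homog UNIV d"
    and grad: "\<And>\<alpha>. grad (Poly_Mapping.lookup g) \<alpha> = A *v grad (Poly_Mapping.lookup f) \<alpha>"
    using primitive_exists[OF A(1) f] by blast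
  have "D \<in> ann g" if D: "D \<in> G" for D
  proof -
    obtain e where e: "D \<in> homog UNIV e" using G(1) D by blast
    moreover have "e \<noteq> d" using e G(3) D by blast
    moreover have "contract D f = 0" using ideal.span_base[OF D] G(2) by (auto simp: ann_def)
    ultimately show ?thesis using contract_primitive_eq_0[OF grad g] by (simp add: ann_def)
  qed
  hence "ideal.span G \<subseteq> ann g" by (intro ideal.span_minimal ann_subspace) blast
  hence "ann f \<inter> homog UNIV d \<subseteq> ann g" using G(2) by blast
  then obtain c where c: "\<And>\<alpha>. Poly_Mapping.lookup g \<alpha> = c * Poly_Mapping.lookup f \<alpha>"
    using multiple_of_form[OF f(1) no_linear_annihilator_nonzero[OF nd] g] by blast
  have "(A - mat c) *v grad (Poly_Mapping.lookup f) \<alpha> = 0" for \<alpha>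
  proof -
    have "mat c *v grad (Poly_Mapping.lookup f) \<alpha> = grad (Poly_Mapping.lookup g) \<alpha>"
      by (simp add: vec_eq_iff grad_mult_component)
        (simp add: mat_def grad_def c if_distrib[of "\<lambda>c. c * _"] cong: if_cong)
    thus ?thesis by (simp add: matrix_vector_mult_diff_rdistrib grad)
  qed
  hence "A - mat c = 0" by (rule no_linear_annihilatorD[OF nd])
  thus False using A(2) by simp
qed

text \<open>
  If the products \<open>\<partial>\<^sub>a D\<close> with \<open>D\<close> in the annihilator of degree \<open>d - 1\<close> do not span its part of degree \<open>d\<close>,
  some functional vanishes on all these products but not on that part. As a form \<open>g\<close> of degree \<open>d\<close>, this
  functional is not a multiple of \<open>f\<close>, while every operator of degree \<open>d - 1\<close> that kills \<open>f\<close> kills \<open>g\<close>;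
  by duality, the partial derivatives of \<open>g\<close> are combinations of those of \<open>f\<close>.
\<close>

lemma min_num_gens_pos_imp_nonscalar:
  fixes f :: "('r::finite, 'k::field) dpow"
  assumes f: "f \<in> homog UNIV d" "d > 0"
    and pos: "min_num_gens (ann f) d > 0"
  obtains A where "self_adjoint A (Poly_Mapping.lookup f)" "A \<notin> range mat"
proof -
  let ?X = "{\<alpha> :: 'r \<Rightarrow>\<^sub>0 nat. mdeg \<alpha> = d}"
  let ?S = "ann f \<inter> homog UNIV (d - 1)"
  define W where "W E = (\<Sum>a\<in>UNIV. Poly_Mapping.single (var a) 1 * E a)" for E :: "'r \<Rightarrow> ('r, 'k) mpoly"
  define V where "V = (\<lambda>E. Poly_Mapping.lookup (W E)) ` {E. \<forall>a. E a \<in> ?S}"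
  have single_mult_homog: "Poly_Mapping.single (var a) 1 * D \<in> homog UNIV d" if "D \<in> homog UNIV (d - 1)"
    for a and D :: "('r, 'k) mpoly"
  proof -
    have "Poly_Mapping.keys (Poly_Mapping.single (var a) 1 * D) \<subseteq> {var a + \<beta> | \<beta>. \<beta> \<in> Poly_Mapping.keys D}"
      using keys_mult[of "Poly_Mapping.single (var a) 1" D] by auto
    moreover have "mdeg \<beta> = d - 1" if "\<beta> \<in> Poly_Mapping.keys D" for \<beta>
      using that \<open>D \<in> _\<close> by (auto simp: homog_iff in_keys_iff)
    ultimately have "mdeg \<beta> = d" if "\<beta> \<in> Poly_Mapping.keys (Poly_Mapping.single (var a) 1 * D)" for \<beta>
      using that f(2) by fastforce
    thus ?thesis by (auto simp: homog_iff in_keys_iff)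
  qed
  have W_homog: "W E \<in> homog UNIV d" if "\<And>a. E a \<in> ?S" for E
    using that single_mult_homog
    by (auto simp: W_def homog_iff lookup_sum intro!: sum.neutral)
  have W_span: "W E \<in> ideal.span ?S" if "\<And>a. E a \<in> ?S" for E
    unfolding W_def using that by (intro ideal.span_sum ideal.span_scale ideal.span_base)
  have "\<exists>v\<in>ann f \<inter> homog UNIV d. \<not> (\<exists>u\<in>V. \<forall>x\<in>?X. u x = Poly_Mapping.lookup v x)"
  proof (rule ccontr)
    assume "\<not> ?thesis"
    hence ex: "\<exists>u\<in>V. \<forall>x\<in>?X. u x = Poly_Mapping.lookup v x" if "v \<in> ann f \<inter> homog UNIV d" for v
      using that by blast
    have top: "ann f \<inter> homog UNIV d \<subseteq> ideal.span ?S"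
    proof
      fix v assume v: "v \<in> ann f \<inter> homog UNIV d"
      from ex[OF this] obtain E where E: "\<And>a. E a \<in> ?S"
        "\<forall>x\<in>?X. Poly_Mapping.lookup (W E) x = Poly_Mapping.lookup v x" by (auto simp: V_def)
      have "W E = v" by (rule homog_eqI[OF W_homog[OF E(1)], of v UNIV]) (use v E(2) in auto)
      moreover have "W E \<in> ideal.span ?S" by (rule W_span[OF E(1)])
      ultimately show "v \<in> ideal.span ?S" by simp
    qed
    have "{..<d} \<subseteq> {..d}" by auto
    obtain G where G: "finite G" "G \<subseteq> (\<Union>e\<in>insert (Suc d) {..<d}. homog UNIV e) - {0}" "ideal.span G = ann f"
    proof (rule generating_set_in_degrees[OF f(1) \<open>{..<d} \<subseteq> {..d}\<close>])
      fix e assume "e \<le> d"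
      let ?U = "\<Union>i\<in>{..<d}. ann f \<inter> homog UNIV i"
      show "ann f \<inter> homog UNIV e \<subseteq> ideal.span ?U"
      proof (cases "e = d")
        case True
        have "d - 1 \<in> {..<d}" using f(2) by simp
        hence "?S \<subseteq> ?U" by blast
        thus ?thesis using top True ideal.span_mono[of ?S ?U] by blast
      next
        case False
        hence "e \<in> {..<d}" using \<open>e \<le> d\<close> by simp
        hence "ann f \<inter> homog UNIV e \<subseteq> ?U" by blast
        thus ?thesis using ideal.span_superset by blast
      qed
    qed
    moreover have "G \<inter> homog UNIV d = {}"
    proof -
      have False if D: "D \<in> G" "D \<in> homog UNIV d" for D
      proof -
        obtain e where "D \<in> homog UNIV e" "e \<noteq> d" "D \<noteq> 0" using G(2) D(1) by fastforce
        thus False using homog_inter_zero D(2) by blast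
      qed
      thus ?thesis by blast
    qed
    moreover have "G \<subseteq> (\<Union>e. homog UNIV e) - {0}" using G(2) by auto
    ultimately have "min_num_gens (ann f) d = 0"
      unfolding min_num_gens_eq_0_iff[OF f(1)] by (intro exI[of _ G] conjI G)
    thus False using pos by simp
  qed
  then obtain v where v: "v \<in> ann f \<inter> homog UNIV d" "\<not> (\<exists>u\<in>V. \<forall>x\<in>?X. u x = Poly_Mapping.lookup v x)"
    by blast
  have closed: "(\<lambda>x. u x + c * w x) \<in> V" if uw: "u \<in> V" "w \<in> V" for u w c
  proof -
    obtain D E where DE: "u = Poly_Mapping.lookup (W D)" "w = Poly_Mapping.lookup (W E)"
      "\<And>a. D a \<in> ?S" "\<And>a. E a \<in> ?S"
      using uw unfolding V_def by blast
    have "(\<lambda>x. u x + c * w x) = Poly_Mapping.lookup (W D + Poly_Mapping.single 0 c * W E)"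
      by (rule ext) (simp add: DE(1,2) lookup_add lookup_const_mult)
    also have "W D + Poly_Mapping.single 0 c * W E = W (\<lambda>a. D a + Poly_Mapping.single 0 c * E a)"
      unfolding W_def sum_distrib_left sum.distrib[symmetric]
      by (rule sum.cong) (simp_all only: distrib_left mult.left_commute)
    finally have "(\<lambda>x. u x + c * w x) = Poly_Mapping.lookup (W (\<lambda>a. D a + Poly_Mapping.single 0 c * E a))" .
    moreover have "D a + Poly_Mapping.single 0 c * E a \<in> ?S" for a
      using DE(3,4)[of a] ideal.subspace_add[OF ann_subspace, of "D a" f] ideal.subspace_scale[OF ann_subspace, of "E a" f]
      by (auto simp: homog_iff lookup_add lookup_const_mult)
    ultimately show ?thesis unfolding V_def by blast
  qed
  have "(\<lambda>_. 0) \<in> {E. \<forall>a. E a \<in> ?S}" using ideal.subspace_0[OF ann_subspace] by (simp add: homog_iff)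
  hence "V \<noteq> {}" unfolding V_def image_is_empty by (metis empty_iff)
  hence "\<exists>g. (\<forall>x. g x \<in> UNIV) \<and> (\<forall>u\<in>V. (\<Sum>x\<in>?X. g x * u x) = 0) \<and> (\<Sum>x\<in>?X. g x * Poly_Mapping.lookup v x) \<noteq> 0"
    by (intro separating_functional[OF finite_mdeg is_subfield_UNIV]) (use closed v(2) in auto)
  then obtain \<gamma> where \<gamma>: "\<And>u. u \<in> V \<Longrightarrow> (\<Sum>x\<in>?X. \<gamma> x * u x) = 0"
    "(\<Sum>x\<in>?X. \<gamma> x * Poly_Mapping.lookup v x) \<noteq> 0" by blast
  define g where "g = form_of d \<gamma>"
  have g: "g \<in> homog UNIV d" unfolding g_def by (rule form_of_homog_UNIV)
  have pg: "pairing D (Poly_Mapping.lookup g) = (\<Sum>x\<in>?X. \<gamma> x * Poly_Mapping.lookup D x)" if "D \<in> homog UNIV d" for D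
    unfolding pairing_homog[OF that] by (rule sum.cong) (auto simp: g_def lookup_form_of mult.commute)
  obtain A where A: "\<And>\<alpha>. grad (Poly_Mapping.lookup g) \<alpha> = A *v grad (Poly_Mapping.lookup f) \<alpha>"
  proof (rule grad_in_span_duality[OF is_subfield_UNIV f(1) g f(2)])
    fix D :: "('r, 'k) mpoly" assume D: "D \<in> homog UNIV (d - 1)" "contract D f = 0"
    show "contract D g = 0"
    proof (rule contract_homog_eq_0[OF D(1) g])
      fix \<alpha> :: "'r \<Rightarrow>\<^sub>0 nat" assume "mdeg \<alpha> + (d - 1) = d"
      hence "mdeg \<alpha> = 1" using f(2) by simp
      then obtain a where a: "Poly_Mapping.lookup (contract D g) \<alpha> = pairing D (\<lambda>\<beta>. Poly_Mapping.lookup g (\<beta> + var a))"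
        by (rule pairing_shift_var)
      let ?E = "\<lambda>b. if b = a then D else 0"
      have S: "\<And>b. ?E b \<in> ?S" using D ideal.subspace_0[OF ann_subspace] by (simp add: homog_iff ann_def)
      have "W ?E = Poly_Mapping.single (var a) 1 * D"
        by (simp add: W_def if_distrib[of "\<lambda>x. _ * x"] cong: if_cong)
      moreover have "Poly_Mapping.lookup (W ?E) \<in> V" unfolding V_def using S by blast
      ultimately have "pairing (Poly_Mapping.single (var a) 1 * D) (Poly_Mapping.lookup g) = 0"
        using pg[OF single_mult_homog[OF D(1)]] \<gamma>(1) by metis
      thus "Poly_Mapping.lookup (contract D g) \<alpha> = 0"
        unfolding a by (simp add: pairing_mult add.commute)
    qed
  qed blast
  have "A \<notin> range mat"
  proof
    assume "A \<in> range mat"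
    then obtain c where c: "A = mat c" by blast
    have "Poly_Mapping.lookup g \<alpha> = c * Poly_Mapping.lookup f \<alpha>" for \<alpha>
    proof (cases "mdeg \<alpha> = d")
      case True
      then obtain i \<beta> where "\<alpha> = \<beta> + var i" using f(2) by (metis mdeg_SucE gr0_conv_Suc)
      thus ?thesis using arg_cong[OF A[of \<beta>], of "\<lambda>v. v $ i"]
        by (simp add: grad_mult_component c)
          (simp add: mat_def grad_def if_distrib[of "\<lambda>c. c * _"] cong: if_cong)
    qed (use f(1) g in \<open>simp add: homog_iff\<close>)
    hence eq: "Poly_Mapping.lookup g = (\<lambda>\<alpha>. c * Poly_Mapping.lookup f \<alpha>)" by (rule ext)
    have "pairing v (Poly_Mapping.lookup g) = c * Poly_Mapping.lookup (contract v f) 0"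
      unfolding eq by (simp add: lookup_contract pairing_linear)
    thus False using v(1) \<gamma>(2) pg[of v] by (simp add: ann_def)
  qed
  thus thesis using that self_adjointI_grad[OF A] by blast
qed

section \<open>From splittings to self-adjoint matrices\<close>

lemma homog_sum:
  assumes "is_subfield L" "\<And>x. x \<in> X \<Longrightarrow> g x \<in> homog L d"
  shows "(\<Sum>x\<in>X. g x) \<in> homog L d"
  using assms by (auto simp: homog_iff lookup_sum intro!: is_subfield_sum sum.neutral)

lemma zero_in_derivs: "0 \<in> L \<Longrightarrow> 0 \<in> derivs L e g"
  unfolding derivs_def by (rule CollectI, rule exI[of _ 0]) (simp add: homog_iff)

lemma single_homog_subfield: "0 \<in> L \<Longrightarrow> c \<in> L \<Longrightarrow> mdeg \<beta> = e \<Longrightarrow> Poly_Mapping.single \<beta> c \<in> homog L e"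
  by (auto simp: homog_iff lookup_single when_def)

lemma grad_scalar_eq:
  assumes "g \<in> homog L d" "F \<in> homog L' d" "d > 0"
    and "\<And>\<alpha>. grad (Poly_Mapping.lookup g) \<alpha> = mat c *v grad (Poly_Mapping.lookup F) \<alpha>"
  shows "Poly_Mapping.lookup g \<alpha> = c * Poly_Mapping.lookup F \<alpha>"
proof (cases "mdeg \<alpha> = d")
  case True
  then obtain i \<beta> where "\<alpha> = \<beta> + var i" using assms(3) by (metis mdeg_SucE gr0_conv_Suc)
  thus ?thesis using arg_cong[OF assms(4)[of \<beta>], of "\<lambda>v. v $ i"]
    by (simp add: grad_mult_component)
      (simp add: mat_def grad_def if_distrib[of "\<lambda>c. c * _"] cong: if_cong)
next
  case False
  thus ?thesis using assms(1,2) by (simp add: homog_iff)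
qed

text \<open>
  An operator of degree \<open>d - 1\<close> that kills \<open>F = \<Sum> g\<^sub>i\<close> kills every summand, because the contractions of the
  summands lie in independent spaces and add up to zero. By duality the partial derivatives of
  \<open>g\<^sub>i\<close> are combinations of those of \<open>F\<close>, with a matrix \<open>A\<^sub>i\<close>. If \<open>A\<^sub>0\<close> and \<open>A\<^sub>1\<close> were both scalar, \<open>g\<^sub>0\<close> and \<open>g\<^sub>1\<close>
  would be proportional, and the spaces \<open>R\<^bsub>d-1\<^esub>(g\<^sub>0)\<close> and \<open>R\<^bsub>d-1\<^esub>(g\<^sub>1)\<close> would coincide without being zero.
\<close>

lemma regular_splitting_imp_nonscalar:
  fixes F :: "('r::finite, 'q::field) dpow"
  assumes L: "is_subfield L" and d: "d > 0" and m: "m \<ge> 2" and split: "regular_splitting L d m F"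
  obtains A where "self_adjoint A (Poly_Mapping.lookup F)" "A \<notin> range mat"
proof -
  obtain g where F: "F = (\<Sum>i<m. g i)" and g: "\<And>i. i < m \<Longrightarrow> g i \<in> homog L d" "\<And>i. i < m \<Longrightarrow> g i \<noteq> 0"
    and indep: "\<And>i. i < m \<Longrightarrow> derivs L (d - 1) (g i) \<inter>
      {\<Sum>j\<in>{..<m} - {i}. h j | h. \<forall>j\<in>{..<m} - {i}. h j \<in> derivs L (d - 1) (g j)} = {0}"
    using split unfolding regular_splitting_def by blast
  note zero = is_subfieldD(1)[OF L]
  have FL: "F \<in> homog L d" unfolding F using g(1) by (intro homog_sum[OF L]) simp
  have kill: "contract D (g i) = 0" if i: "i < m" and D: "D \<in> homog L (d - 1)" "contract D F = 0" for i D
  proof -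
    have "0 = (\<Sum>j<m. contract D (g j))" using D(2) by (simp add: F contract_sum_right)
    also have "\<dots> = contract D (g i) + (\<Sum>j\<in>{..<m} - {i}. contract D (g j))"
      using i by (intro sum.remove) auto
    finally have "contract D (g i) = (\<Sum>j\<in>{..<m} - {i}. contract (- D) (g j))"
      by (simp add: contract_uminus sum_negf eq_neg_iff_add_eq_0)
    moreover have "- D \<in> homog L (d - 1)" using D(1) is_subfieldD(6)[OF L] by (simp add: homog_iff)
    hence "\<forall>j\<in>{..<m} - {i}. contract (- D) (g j) \<in> derivs L (d - 1) (g j)"
      unfolding derivs_def by blast
    moreover have "contract D (g i) \<in> derivs L (d - 1) (g i)" using D(1) unfolding derivs_def by blast
    ultimately have "contract D (g i) \<in> derivs L (d - 1) (g i) \<inter>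
      {\<Sum>j\<in>{..<m} - {i}. h j | h. \<forall>j\<in>{..<m} - {i}. h j \<in> derivs L (d - 1) (g j)}" by blast
    thus ?thesis using indep[OF i] by blast
  qed
  have "\<exists>A. (\<forall>k l. A $ k $ l \<in> L) \<and>
      (\<forall>\<alpha>. grad (Poly_Mapping.lookup (g i)) \<alpha> = A *v grad (Poly_Mapping.lookup F) \<alpha>)" if "i < m" for i
    using grad_in_span_duality[OF L FL g(1)[OF that] d kill[OF that]] by metis
  then obtain A where AL: "\<And>i k l. i < m \<Longrightarrow> A i $ k $ l \<in> L"
    and A: "\<And>i \<alpha>. i < m \<Longrightarrow> grad (Poly_Mapping.lookup (g i)) \<alpha> = A i *v grad (Poly_Mapping.lookup F) \<alpha>"
    by metis
  have lt: "0 < m" "1 < m" using m by auto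
  have "A 0 \<notin> range mat \<or> A 1 \<notin> range mat"
  proof (rule ccontr)
    assume "\<not> ?thesis"
    then obtain c e where c: "A 0 = mat c" and e: "A 1 = mat e" by blast
    have "c \<in> L" "e \<in> L"
      using AL[OF lt(1), of undefined undefined, unfolded c]
        AL[OF lt(2), of undefined undefined, unfolded e] by (simp_all add: mat_def)
    have g0: "Poly_Mapping.lookup (g 0) \<alpha> = c * Poly_Mapping.lookup F \<alpha>" for \<alpha>
      by (rule grad_scalar_eq[OF g(1)[OF lt(1)] FL d]) (use A[OF lt(1)] c in simp)
    have g1: "Poly_Mapping.lookup (g 1) \<alpha> = e * Poly_Mapping.lookup F \<alpha>" for \<alpha>
      by (rule grad_scalar_eq[OF g(1)[OF lt(2)] FL d]) (use A[OF lt(2)] e in simp)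
    have e0: "e \<noteq> 0"
    proof
      assume "e = 0"
      hence "g 1 = 0" by (intro poly_mapping_eqI) (simp add: g1 del: One_nat_def)
      thus False using g(2)[OF lt(2)] by simp
    qed
    obtain \<alpha> where \<alpha>: "Poly_Mapping.lookup (g 0) \<alpha> \<noteq> 0"
      using g(2)[OF lt(1)] by (metis poly_mapping_eqI lookup_zero)
    hence "mdeg \<alpha> = d" using g(1)[OF lt(1)] by (auto simp: homog_iff)
    then obtain k \<beta> where k: "\<alpha> = \<beta> + var k" "mdeg \<beta> = d - 1"
      using d by (metis mdeg_SucE gr0_conv_Suc diff_Suc_1)
    let ?x = "contract (Poly_Mapping.single \<beta> 1) (g 0)"
    have x: "?x = contract (Poly_Mapping.single \<beta> (c / e)) (g 1)"
      using e0 by (intro poly_mapping_eqI) (simp add: lookup_contract g0 g1 del: One_nat_def)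
    have "Poly_Mapping.single \<beta> 1 \<in> homog L (d - 1)" "Poly_Mapping.single \<beta> (c / e) \<in> homog L (d - 1)"
      using k(2) \<open>c \<in> L\<close> \<open>e \<in> L\<close> is_subfieldD(1,2,5)[OF L] by (auto intro!: single_homog_subfield)
    hence "?x \<in> derivs L (d - 1) (g 0)" and x1: "?x \<in> derivs L (d - 1) (g 1)"
      using x unfolding derivs_def by blast+
    moreover have "?x \<in> {\<Sum>j\<in>{..<m} - {0}. h j | h. \<forall>j\<in>{..<m} - {0}. h j \<in> derivs L (d - 1) (g j)}"
      using lt x1 zero_in_derivs[OF zero]
      by (intro CollectI exI[of _ "\<lambda>j. if j = 1 then ?x else 0"]) auto
    ultimately have "?x = 0" using indep[OF lt(1)] by blast
    hence "Poly_Mapping.lookup ?x (var k) = 0" by simp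
    thus False using \<alpha> by (simp add: lookup_contract k(1) add.commute)
  qed
  thus thesis using that A lt self_adjointI_grad by metis
qed

section \<open>Splittings of length two\<close>

text \<open>
  Contraction with an operator commutes with taking gradients, so the linear forms in the first
  space \<open>R\<^bsub>d-1\<^esub>(g)\<close> are multiplied by \<open>c\<close> under \<open>N\<close> and those in the second space are killed by \<open>N\<close>.
\<close>

lemma regular_splitting_two:
  fixes g h :: "('r::finite, 'q::field) dpow"
  assumes L: "is_subfield L" and d: "d > 0"
    and g: "g \<in> homog L d" "g \<noteq> 0" and h: "h \<in> homog L d" "h \<noteq> 0"
    and c: "c \<noteq> 0"
    and Ng: "\<And>\<alpha>. N *v grad (Poly_Mapping.lookup g) \<alpha> = c *s grad (Poly_Mapping.lookup g) \<alpha>"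
    and Nh: "\<And>\<alpha>. N *v grad (Poly_Mapping.lookup h) \<alpha> = 0"
  shows "regular_splitting L d 2 (g + h)"
proof -
  note zero = is_subfieldD(1)[OF L]
  have key: "x = 0" if "x \<in> derivs L (d - 1) g" "x \<in> derivs L (d - 1) h" for x
  proof -
    obtain D E where D: "x = contract D g" and E: "x = contract E h" "D \<in> homog L (d - 1)"
      using \<open>x \<in> derivs L (d - 1) g\<close> \<open>x \<in> derivs L (d - 1) h\<close> unfolding derivs_def by blast
    have comm: "N *v grad (Poly_Mapping.lookup (contract D' p)) 0 =
        (\<chi> i. pairing D' (\<lambda>\<beta>. (N *v grad (Poly_Mapping.lookup p) \<beta>) $ i))" for D' p
      by (simp add: vec_eq_iff grad_mult_component lookup_contract pairing_linear add.commute)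
    have "c *s grad (Poly_Mapping.lookup x) 0 = N *v grad (Poly_Mapping.lookup x) 0"
      unfolding D comm Ng by (simp add: vec_eq_iff pairing_linear)
        (simp add: grad_def lookup_contract add.commute)
    also have "\<dots> = 0" unfolding E comm Nh by (simp add: vec_eq_iff pairing_linear)
    finally have x: "Poly_Mapping.lookup x (var i) = 0" for i
      using c by (simp add: vec_eq_iff grad_def)
    show "x = 0" unfolding D
    proof (rule contract_homog_eq_0[OF E(2) g(1)])
      fix \<alpha> :: "'r \<Rightarrow>\<^sub>0 nat" assume "mdeg \<alpha> + (d - 1) = d"
      hence "mdeg \<alpha> = Suc 0" using d by simp
      then obtain i \<beta> where "\<alpha> = \<beta> + var i" "mdeg \<beta> = 0" by (rule mdeg_SucE)
      thus "Poly_Mapping.lookup (contract D g) \<alpha> = 0" using x[of i] D by simp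
    qed
  qed
  define p where "p i = (if i = 0 then g else h)" for i :: nat
  have indep: "derivs L (d - 1) (p i) \<inter>
      {\<Sum>j\<in>{..<2} - {i}. q j | q. \<forall>j\<in>{..<2} - {i}. q j \<in> derivs L (d - 1) (p j)} = {0}" if "i < 2" for i
  proof -
    have "i = 0 \<or> i = 1" using that by auto
    hence "{..<2} - {i} = {1 - i}" by auto
    hence "{\<Sum>j\<in>{..<2} - {i}. q j | q. \<forall>j\<in>{..<2} - {i}. q j \<in> derivs L (d - 1) (p j)} =
        derivs L (d - 1) (p (1 - i))" by auto
    moreover have "derivs L (d - 1) (p i) \<inter> derivs L (d - 1) (p (1 - i)) = {0}"
      using key zero_in_derivs[OF zero] that by (cases i) (auto simp: p_def)
    ultimately show ?thesis by simp
  qed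
  have "g + h = (\<Sum>i<2. p i)" by (simp add: p_def numeral_2_eq_2)
  thus ?thesis unfolding regular_splitting_def using g h indep
    by (intro exI[of _ p]) (simp add: p_def)
qed

text \<open>
  For \<open>\<nabla>g = E \<nabla>f\<close> the gradients of \<open>g\<close> lie in the image of \<open>E\<close>, those of \<open>f - g\<close> in its kernel.
\<close>

lemma idempotent_imp_regular_splitting:
  fixes f :: "('r::finite, 'k::field) dpow"
  assumes f: "f \<in> homog UNIV d" "d > 0" and nd: "ann f \<inter> homog UNIV 1 = {0}"
    and E: "self_adjoint E (Poly_Mapping.lookup f)" "E ** E = E" "E \<noteq> 0" "E \<noteq> mat 1"
  shows "regular_splitting UNIV d 2 f"
proof -
  obtain g where g: "g \<in> homog UNIV d"
    and grad: "\<And>\<alpha>. grad (Poly_Mapping.lookup g) \<alpha> = E *v grad (Poly_Mapping.lookup f) \<alpha>"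
    using primitive_exists[OF E(1) f] by blast
  have h: "f - g \<in> homog UNIV d" using f(1) g by (simp add: homog_iff lookup_minus)
  have grad': "grad (Poly_Mapping.lookup (f - g)) \<alpha> = (mat 1 - E) *v grad (Poly_Mapping.lookup f) \<alpha>" for \<alpha>
  proof -
    have "grad (Poly_Mapping.lookup (f - g)) \<alpha> =
        grad (Poly_Mapping.lookup f) \<alpha> - grad (Poly_Mapping.lookup g) \<alpha>"
      by (simp add: vec_eq_iff grad_def lookup_minus)
    thus ?thesis by (simp add: grad matrix_vector_mult_diff_rdistrib)
  qed
  have "g \<noteq> 0"
  proof
    assume "g = 0"
    hence "\<And>\<alpha>. E *v grad (Poly_Mapping.lookup f) \<alpha> = 0"
      unfolding grad[symmetric] by (simp add: grad_def vec_eq_iff)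
    thus False using no_linear_annihilatorD[OF nd] E(3) by blast
  qed
  moreover have "f - g \<noteq> 0"
  proof
    assume "f - g = 0"
    hence "\<And>\<alpha>. (mat 1 - E) *v grad (Poly_Mapping.lookup f) \<alpha> = 0"
      unfolding grad'[symmetric] by (simp add: grad_def vec_eq_iff)
    hence "mat 1 - E = 0" using no_linear_annihilatorD[OF nd] by blast
    thus False using E(4) by simp
  qed
  ultimately have "regular_splitting UNIV d 2 (g + (f - g))"
  proof (intro regular_splitting_two[OF is_subfield_UNIV f(2) g _ h, of 1 E])
    show "E *v grad (Poly_Mapping.lookup g) \<alpha> = 1 *s grad (Poly_Mapping.lookup g) \<alpha>" for \<alpha>
      by (simp add: grad matrix_vector_mul_assoc E(2))
    show "E *v grad (Poly_Mapping.lookup (f - g)) \<alpha> = 0" for \<alpha>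
      by (simp add: grad' matrix_vector_mult_diff_rdistrib matrix_vector_mult_diff_distrib
          matrix_vector_mul_assoc E(2))
  qed auto
  thus ?thesis by simp
qed

section \<open>Ring homomorphisms and rational functions\<close>

definition is_hom :: "('a::comm_ring_1 \<Rightarrow> 'b::comm_ring_1) \<Rightarrow> bool" where
  "is_hom h \<longleftrightarrow> h 0 = 0 \<and> h 1 = 1 \<and> (\<forall>x y. h (x + y) = h x + h y) \<and> (\<forall>x y. h (x * y) = h x * h y)"

lemma is_homD:
  assumes "is_hom h"
  shows "h 0 = 0" "h 1 = 1" "h (x + y) = h x + h y" "h (x * y) = h x * h y"
  using assms by (simp_all add: is_hom_def)

lemma is_hom_sum: "is_hom h \<Longrightarrow> h (\<Sum>x\<in>X. f x) = (\<Sum>x\<in>X. h (f x))"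
  by (induction X rule: infinite_finite_induct) (auto simp: is_homD)

lemma map_matrix_mult: "is_hom h \<Longrightarrow> map_matrix h (A ** B) = map_matrix h A ** map_matrix h B"
  by (simp add: vec_eq_iff map_matrix_def matrix_matrix_mult_def is_hom_sum is_homD)

lemma map_matrix_grad:
  assumes "is_hom h"
  shows "map_matrix h A *v grad (\<lambda>\<alpha>. h (\<phi> \<alpha>)) \<alpha> = (\<chi> i. h ((A *v grad \<phi> \<alpha>) $ i))"
  by (simp add: vec_eq_iff grad_mult_component is_hom_sum[OF assms] is_homD[OF assms] map_matrix_def)

lemma is_hom_const_poly: "is_hom (\<lambda>c. [:c:])"
  by (simp add: is_hom_def one_pCons)

lemma is_hom_Fract: "is_hom (\<lambda>p. Fract p 1)"
  by (simp add: is_hom_def Zero_fract_def One_fract_def)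

lemma Fract_1_eq_0_iff: "Fract p 1 = 0 \<longleftrightarrow> p = 0"
  by (simp add: Zero_fract_def eq_fract)

lemma tpolys_add: "p \<in> tpolys n \<Longrightarrow> q \<in> tpolys n \<Longrightarrow> p + q \<in> tpolys n"
  using keys_add[of p q] by (auto simp: tpolys_def)

lemma tpolys_mult: 
  fixes p q :: "'k::comm_ring_1 tpoly"
  assumes "p \<in> tpolys n" "q \<in> tpolys n"
  shows "p * q \<in> tpolys n"
proof -
  have "Poly_Mapping.keys \<gamma> \<subseteq> {..<n}" if \<gamma>: "\<gamma> \<in> Poly_Mapping.keys (p * q)" for \<gamma>
  proof -
    obtain \<delta> \<epsilon> where "\<gamma> = \<delta> + \<epsilon>" "\<delta> \<in> Poly_Mapping.keys p" "\<epsilon> \<in> Poly_Mapping.keys q"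
      using \<gamma> keys_mult[of p q] by blast
    thus ?thesis using assms keys_add[of \<delta> \<epsilon>] unfolding tpolys_def by blast
  qed
  thus ?thesis by (simp add: tpolys_def)
qed

lemma tpolys_uminus: "p \<in> tpolys n \<Longrightarrow> - p \<in> tpolys (n::nat)" for p :: "'k::comm_ring_1 tpoly"
  by (auto simp: tpolys_def in_keys_iff)

lemma tpolys_const: "Poly_Mapping.single 0 c \<in> tpolys n"
  by (auto simp: tpolys_def in_keys_iff lookup_single when_def split: if_splits)

lemma ratfunsI: "a \<in> tpolys n \<Longrightarrow> b \<in> tpolys n \<Longrightarrow> b \<noteq> 0 \<Longrightarrow> Fract a b \<in> ratfuns n"
  unfolding ratfuns_def by blast

lemma is_subfield_ratfuns: "is_subfield (ratfuns n :: 'k::field tpoly fract set)"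
  unfolding is_subfield_def
proof (intro conjI ballI)
  have one: "(1 :: 'k tpoly) \<in> tpolys n" and zero: "(0 :: 'k tpoly) \<in> tpolys n"
    using tpolys_const[of "1::'k" n] tpolys_const[of "0::'k" n] by simp_all
  show *: "(0 :: 'k tpoly fract) \<in> ratfuns n" unfolding Zero_fract_def by (rule ratfunsI[OF zero one one_neq_zero])
  show "(1 :: 'k tpoly fract) \<in> ratfuns n" unfolding One_fract_def by (rule ratfunsI[OF one one one_neq_zero])
  fix x y :: "'k tpoly fract" assume "x \<in> ratfuns n" "y \<in> ratfuns n"
  then obtain a b c e where x: "x = Fract a b" "a \<in> tpolys n" "b \<in> tpolys n" "b \<noteq> 0"
    and y: "y = Fract c e" "c \<in> tpolys n" "e \<in> tpolys n" "e \<noteq> 0" unfolding ratfuns_def by blast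
  have "x - y = Fract (a * e + - (c * b)) (b * e)" using x y by simp
  thus "x - y \<in> ratfuns n" using x y
    by (simp only:) (intro ratfunsI tpolys_add tpolys_mult tpolys_uminus, simp_all)
  have "x * y = Fract (a * c) (b * e)" using x y by simp
  thus "x * y \<in> ratfuns n" using x y
    by (simp only:) (intro ratfunsI tpolys_mult, simp_all)
  show "x / y \<in> ratfuns n"
  proof (cases "c = 0")
    case True
    hence "y = 0" using y by (simp add: Zero_fract_def eq_fract)
    thus ?thesis using * by simp
  next
    case False
    have "x / y = Fract (a * e) (b * c)" using x y by simp
    thus ?thesis using x y False
      by (simp only:) (intro ratfunsI tpolys_mult, simp_all)
  qed
qed

text \<open>
  A single parameter suffices for the degenerate splitting below. The family is constructed over
  \<open>K[t]\<close>, where coefficients with respect to \<open>t\<close> are directly accessible, and then carried over by \<open>t \<mapsto> t\<^sub>1\<close>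
  (the variable with number \<open>0\<close>).
\<close>

definition tpoly_of_poly :: "'k::field poly \<Rightarrow> 'k tpoly" where
  "tpoly_of_poly p = poly (map_poly (Poly_Mapping.single 0) p) (Poly_Mapping.single (var 0) 1)"

lemma tpoly_of_poly_0 [simp]: "tpoly_of_poly 0 = 0"
  by (simp add: tpoly_of_poly_def)

lemma tpoly_of_poly_pCons [simp]:
  "tpoly_of_poly (pCons c p) = Poly_Mapping.single 0 c + Poly_Mapping.single (var 0) 1 * tpoly_of_poly p"
  by (simp add: tpoly_of_poly_def map_poly_pCons)

lemma is_hom_tpoly_of_poly: "is_hom tpoly_of_poly"
proof -
  have add: "tpoly_of_poly (p + q) = tpoly_of_poly p + tpoly_of_poly q" for p q :: "'a poly"
    by (induction p q rule: poly_induct2) (simp_all add: single_add algebra_simps)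
  have smult: "tpoly_of_poly (smult c p) = Poly_Mapping.single 0 c * tpoly_of_poly p" for c and p :: "'a poly"
    by (induction p) (simp_all add: mult_single distrib_left mult.left_commute)
  have "tpoly_of_poly (p * q) = tpoly_of_poly p * tpoly_of_poly q" for p q :: "'a poly"
  proof (induction p)
    case (pCons a p)
    have "tpoly_of_poly (pCons a p * q) = tpoly_of_poly (smult a q) + tpoly_of_poly (pCons 0 (p * q))"
      by (simp only: mult_pCons_left add)
    also have "\<dots> = Poly_Mapping.single 0 a * tpoly_of_poly q +
        Poly_Mapping.single (var 0) 1 * (tpoly_of_poly p * tpoly_of_poly q)"
      by (simp only: smult tpoly_of_poly_pCons pCons.IH single_zero add_0)
    also have "\<dots> = tpoly_of_poly (pCons a p) * tpoly_of_poly q"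
      by (simp only: tpoly_of_poly_pCons distrib_right mult.assoc)
    finally show ?case .
  qed simp
  thus ?thesis using add by (simp add: is_hom_def one_pCons)
qed

lemma lookup_var_mult_0: "Poly_Mapping.lookup (Poly_Mapping.single (var i) 1 * (p :: 'k::comm_ring_1 tpoly)) 0 = 0"
proof (rule ccontr)
  assume "Poly_Mapping.lookup (Poly_Mapping.single (var i) 1 * p) 0 \<noteq> 0"
  hence "0 \<in> Poly_Mapping.keys (Poly_Mapping.single (var i) 1 * p)" by (simp add: in_keys_iff)
  then obtain \<gamma> :: "nat \<Rightarrow>\<^sub>0 nat" where "0 = var i + \<gamma>"
    using keys_mult[of "Poly_Mapping.single (var i) 1" p] by (auto split: if_splits)
  hence "Poly_Mapping.lookup 0 i = Poly_Mapping.lookup (var i + \<gamma>) i" by (rule arg_cong)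
  thus False by (simp add: lookup_add lookup_var)
qed

lemma lookup_tpoly_of_poly_0: "Poly_Mapping.lookup (tpoly_of_poly p) 0 = coeff p 0"
  by (cases p) (simp add: lookup_add lookup_var_mult_0)

lemma tpoly_of_poly_eq_0: "tpoly_of_poly p = 0 \<Longrightarrow> p = 0"
proof (induction p)
  case (pCons c p)
  hence "c = 0" using lookup_tpoly_of_poly_0[of "pCons c p"] by simp
  moreover have "Poly_Mapping.single (var (0::nat)) (1::'a) \<noteq> 0"
    by (metis lookup_single_eq lookup_zero one_neq_zero)
  ultimately have "tpoly_of_poly p = 0" using pCons.prems by simp
  thus ?case using pCons.IH \<open>c = 0\<close> by simp
qed simp

lemma tpoly_of_poly_in_tpolys: "tpoly_of_poly p \<in> tpolys 1"
proof (induction p)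
  case 0
  show ?case using tpolys_const[of "0::'a" 1] by simp
next
  case (pCons c p)
  have "Poly_Mapping.single (var (0::nat)) (1::'a) \<in> tpolys 1"
    by (auto simp: tpolys_def in_keys_iff lookup_single when_def lookup_var split: if_splits)
  thus ?case using pCons by (simp add: tpolys_add tpolys_mult tpolys_const del: One_nat_def)
qed

definition ratfun_of_poly :: "'k::field poly \<Rightarrow> 'k tpoly fract" where
  "ratfun_of_poly p = Fract (tpoly_of_poly p) 1"

lemma is_hom_ratfun_of_poly: "is_hom ratfun_of_poly"
  by (simp add: is_hom_def ratfun_of_poly_def is_homD[OF is_hom_tpoly_of_poly] Zero_fract_def One_fract_def)

lemma ratfun_of_poly_eq_0_iff: "ratfun_of_poly p = 0 \<longleftrightarrow> p = 0"
  using tpoly_of_poly_eq_0[of p] by (auto simp: ratfun_of_poly_def Fract_1_eq_0_iff)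

lemma ratfun_of_poly_in_ratfuns: "ratfun_of_poly p \<in> ratfuns 1"
proof -
  have "(1 :: 'a tpoly) \<in> tpolys 1" using tpolys_const[of "1::'a" 1] by simp
  thus ?thesis unfolding ratfun_of_poly_def
    by (rule ratfunsI[OF tpoly_of_poly_in_tpolys _ one_neq_zero])
qed

section \<open>Linear substitutions\<close>

text \<open>
  The linear substitution with matrix \<open>P\<close> acts on divided power forms as the dual of the algebra
  endomorphism \<open>\<partial>\<^sub>i \<mapsto> \<Sum>\<^sub>a P\<^sub>i\<^sub>a \<partial>\<^sub>a\<close> of \<open>R\<close>: the coefficient of the new form at \<open>\<alpha>\<close> is the pairing of the old one with
  the image of \<open>\<partial>\<^sup>\<alpha>\<close>. The only product that enters is that of \<open>R\<close>.
\<close>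

definition subst_monomial :: "'k::comm_ring_1^'r^'r \<Rightarrow> ('r::finite \<Rightarrow>\<^sub>0 nat) \<Rightarrow> ('r, 'k) mpoly" where
  "subst_monomial P \<alpha> = (\<Prod>i\<in>UNIV. linear_op (P $ i) ^ Poly_Mapping.lookup \<alpha> i)"

lemma subst_monomial_0 [simp]: "subst_monomial P 0 = 1"
  by (simp add: subst_monomial_def)

lemma subst_monomial_add_var: "subst_monomial P (\<alpha> + var i) = linear_op (P $ i) * subst_monomial P \<alpha>"
proof -
  have "linear_op (P $ j) ^ (if i = j then 1 else 0) = (if i = j then linear_op (P $ i) else 1)" for j
    by simp
  hence "(\<Prod>j\<in>UNIV. linear_op (P $ j) ^ (if i = j then 1 else 0)) = linear_op (P $ i)"
    by simp
  thus ?thesis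
    by (simp add: subst_monomial_def lookup_add lookup_var power_add prod.distrib mult.commute)
qed

definition pullback :: "'k::comm_ring_1^'r^'r \<Rightarrow> (('r::finite \<Rightarrow>\<^sub>0 nat) \<Rightarrow> 'k) \<Rightarrow> ('r \<Rightarrow>\<^sub>0 nat) \<Rightarrow> 'k" where
  "pullback P \<phi> \<alpha> = pairing (subst_monomial P \<alpha>) \<phi>"

text \<open>The chain rule. The vector on the right is the gradient of \<open>\<phi>\<close>, pulled back entrywise.\<close>

lemma grad_pullback:
  "grad (pullback P \<phi>) \<alpha> = P *v (\<chi> a. pullback P (\<lambda>\<beta>. \<phi> (\<beta> + var a)) \<alpha>)"
  by (simp add: vec_eq_iff grad_def pullback_def subst_monomial_add_var pairing_mult
      pairing_linear_op matrix_vector_mult_def add.commute)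

lemma pullback_matrix:
  assumes "\<And>\<beta>. grad \<psi> \<beta> = A *v grad \<phi> \<beta>"
  shows "(\<chi> a. pullback P (\<lambda>\<beta>. \<psi> (\<beta> + var a)) \<alpha>) = A *v (\<chi> a. pullback P (\<lambda>\<beta>. \<phi> (\<beta> + var a)) \<alpha>)"
proof -
  have "\<psi> (\<beta> + var i) = (\<Sum>a\<in>UNIV. A $ i $ a * \<phi> (\<beta> + var a))" for \<beta> i
    using arg_cong[OF assms[of \<beta>], of "\<lambda>v. v $ i"]
    by (simp add: grad_mult_component) (simp add: grad_def)
  thus ?thesis by (simp add: vec_eq_iff pullback_def pairing_linear matrix_vector_mult_def)
qed

lemma subst_monomial_cong_1:
  fixes S :: "'k::comm_ring_1^'r^'r"
  shows "Poly_Mapping.single 0 t dvd subst_monomial (mat 1 + mat t ** S) \<alpha> - Poly_Mapping.single \<alpha> 1"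
proof (induction "mdeg \<alpha>" arbitrary: \<alpha>)
  case 0
  thus ?case by simp
next
  case (Suc n)
  then obtain i \<beta> where \<alpha>: "\<alpha> = \<beta> + var i" and "mdeg \<beta> = n" by (metis mdeg_SucE)
  let ?P = "mat 1 + mat t ** S" and ?t = "Poly_Mapping.single 0 t"
  let ?l = "linear_op (?P $ i)" and ?v = "Poly_Mapping.single (var i) (1 :: 'k)"
  have lin: "?l = ?v + ?t * linear_op (S $ i)"
    by (simp add: linear_op_def mat_mult_component sum.distrib single_add sum_distrib_left mult_single)
      (simp add: mat_def if_distrib[of "Poly_Mapping.single _"] cong: if_cong)
  have ring: "l * M - v * m = l * (M - m) + (l - v) * m" for l M v m :: "('r, 'k) mpoly"
    by (simp only: left_diff_distrib right_diff_distrib) simp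
  have v: "Poly_Mapping.single \<alpha> (1 :: 'k) = ?v * Poly_Mapping.single \<beta> 1"
    by (simp add: mult_single \<alpha> add.commute)
  have diff: "?l - ?v = ?t * linear_op (S $ i)" unfolding lin by (rule add_diff_cancel_left')
  have eq: "subst_monomial ?P \<alpha> - Poly_Mapping.single \<alpha> 1 =
      ?l * (subst_monomial ?P \<beta> - Poly_Mapping.single \<beta> 1) + ?t * linear_op (S $ i) * Poly_Mapping.single \<beta> 1"
    unfolding v diff[symmetric] unfolding \<alpha> subst_monomial_add_var by (rule ring)
  have "?t dvd subst_monomial ?P \<beta> - Poly_Mapping.single \<beta> 1"
    using Suc.hyps(1)[of \<beta>] \<open>mdeg \<beta> = n\<close> by simp
  thus ?case unfolding eq by (intro dvd_add dvd_mult dvd_mult2[OF dvd_triv_left])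
qed

text \<open>At \<open>t = 0\<close> the substitution with matrix \<open>1 + t S\<close> is the identity.\<close>

lemma coeff_pullback_0:
  "coeff (pullback (mat 1 + mat [:0, 1:] ** S) (\<lambda>\<beta>. [:\<phi> \<beta>:]) \<alpha>) 0 = \<phi> \<alpha>"
proof -
  obtain Q where "subst_monomial (mat 1 + mat [:0, 1:] ** S) \<alpha> - Poly_Mapping.single \<alpha> 1 =
      Poly_Mapping.single 0 [:0, 1:] * Q"
    using subst_monomial_cong_1 by (rule dvdE)
  hence "subst_monomial (mat 1 + mat [:0, 1:] ** S) \<alpha> =
      Poly_Mapping.single \<alpha> 1 + Poly_Mapping.single 0 [:0, 1:] * Q"
    by (simp add: diff_eq_eq add.commute)
  thus ?thesis by (simp add: pullback_def pairing_add pairing_mult)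
qed

section \<open>Nilpotent matrices and degenerate splittings\<close>

lemma matrix_vector_mult_smult: "A *v (c *s x) = c *s (A *v (x :: 'k::comm_ring_1^'n))"
  unfolding vec_eq_iff matrix_vector_mult_def vec_lambda_beta vector_smult_component sum_distrib_left
  by (intro allI sum.cong refl mult.left_commute)

lemma mat_vector_mult: "mat c *v x = c *s (x :: 'k::comm_ring_1^'n)"
  by (simp add: vec_eq_iff matrix_vector_mult_def mat_def if_distrib[of "\<lambda>c. c * _"] cong: if_cong)

text \<open>
  Here \<open>P = 1 + t S\<close>, and \<open>G\<close> is the pullback of \<open>g\<close> along \<open>P\<close>. The matrix \<open>N = P A\<close> satisfies \<open>N\<^sup>2 = t N\<close>, because
  \<open>A P A = A\<^sup>2 + t A S A = t A\<close>. By the chain rule the gradients of \<open>G\<close> lie in the image of \<open>N\<close>, so \<open>N\<close> multiplies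
  them by \<open>t\<close>. On the other hand \<open>A \<nabla>g = A\<^sup>2 \<nabla>f = 0\<close>, and comparing the coefficients of \<open>t\<close> in
  \<open>A \<nabla>G = t A (\<nabla>f)(P)\<close> gives \<open>A \<nabla>g\<^sub>1 = A \<nabla>f\<close>, since \<open>P = 1\<close> at \<open>t = 0\<close>. Therefore \<open>N\<close> kills the gradients of
  \<open>H = t (f - g\<^sub>1) - g\<close>. The sum \<open>G + H\<close> is divisible by \<open>t\<close>, and the quotient is \<open>f\<close> at \<open>t = 0\<close>. The constant terms
  \<open>g\<close> and \<open>-g\<close> show that \<open>G\<close> and \<open>H\<close> are not zero.
\<close>

lemma square_zero_imp_degenerate_splitting:
  fixes f :: "('r::finite, 'k::field) dpow"
  assumes f: "f \<in> homog UNIV d" "d > 0" and nd: "ann f \<inter> homog UNIV 1 = {0}"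
    and A: "self_adjoint A (Poly_Mapping.lookup f)" "A \<noteq> 0" "A ** A = 0"
  shows "degenerate_splitting d 2 f"
proof -
  let ?f = "Poly_Mapping.lookup f"
  obtain g where g: "g \<in> homog UNIV d"
    and grad: "\<And>\<alpha>. grad (Poly_Mapping.lookup g) \<alpha> = A *v grad ?f \<alpha>"
    using primitive_exists[OF A(1) f] by blast
  let ?g = "Poly_Mapping.lookup g"
  have "g \<noteq> 0"
  proof
    assume "g = 0"
    hence "\<And>\<alpha>. A *v grad ?f \<alpha> = 0" unfolding grad[symmetric] by (simp add: grad_def vec_eq_iff)
    thus False using no_linear_annihilatorD[OF nd] A(2) by blast
  qed
  then obtain \<alpha>\<^sub>0 where \<alpha>\<^sub>0: "?g \<alpha>\<^sub>0 \<noteq> 0" by (metis poly_mapping_eqI lookup_zero)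
  have \<alpha>\<^sub>0_deg: "mdeg \<alpha>\<^sub>0 = d" using \<alpha>\<^sub>0 g by (auto simp: homog_iff)
  obtain S where S: "A ** S ** A = A" by (rule generalized_inverse_exists)

  \<comment> \<open>All the following takes place over \<open>K[t]\<close>.\<close>
  define c where "c = (\<lambda>a::'k. [:a:])"
  have c: "is_hom c" unfolding c_def by (rule is_hom_const_poly)
  define t where "t = [:0, 1 :: 'k:]"
  define A' where "A' = map_matrix c A"
  define S' where "S' = map_matrix c S"
  define P where "P = mat 1 + mat t ** S'"
  define N where "N = P ** A'"
  have "map_matrix c (0 :: 'k^'r^'r) = 0" by (simp add: vec_eq_iff map_matrix_def c_def)
  hence AA: "A' ** A' = 0" unfolding A'_def map_matrix_mult[OF c, symmetric] A(3) .
  have ASA: "A' ** S' ** A' = A'"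
    unfolding A'_def S'_def map_matrix_mult[OF c, symmetric] S ..
  have "A' ** P = A' + mat t ** (A' ** S')"
    unfolding P_def matrix_add_ldistrib matrix_mul_rid
    by (simp only: matrix_mul_assoc mult_mat_commute[of A' t])
  hence "A' ** N = A' ** A' + mat t ** (A' ** S' ** A')"
    unfolding N_def by (simp only: matrix_mult_add_left matrix_mul_assoc)
  hence APA: "A' ** N = mat t ** A'" by (simp only: AA ASA add_0)
  have "N ** N = P ** (A' ** N)" by (simp only: N_def matrix_mul_assoc)
  also have "\<dots> = mat t ** N"
    unfolding APA by (simp only: N_def matrix_mul_assoc mult_mat_commute[of P t])
  finally have NN: "N ** N = mat t ** N" .

  define \<phi> where "\<phi> = (\<lambda>\<beta>. c (?f \<beta>))"
  define \<gamma> where "\<gamma> = (\<lambda>\<beta>. c (?g \<beta>))"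
  have grad_\<gamma>: "grad \<gamma> \<beta> = A' *v grad \<phi> \<beta>" for \<beta>
    unfolding A'_def \<phi>_def map_matrix_grad[OF c] grad[symmetric] by (simp add: grad_def \<gamma>_def)
  define G where "G = pullback P \<gamma>"
  define M where "M \<alpha> = (\<chi> a. pullback P (\<lambda>\<beta>. \<phi> (\<beta> + var a)) \<alpha>)" for \<alpha>
  have grad_G: "grad G \<alpha> = N *v M \<alpha>" for \<alpha>
    unfolding G_def grad_pullback pullback_matrix[OF grad_\<gamma>] M_def N_def matrix_vector_mul_assoc ..
  have NG: "N *v grad G \<alpha> = t *s grad G \<alpha>" for \<alpha>
    unfolding grad_G matrix_vector_mul_assoc NN
    by (simp only: mat_vector_mult flip: matrix_vector_mul_assoc)
  have G0: "coeff (G \<alpha>) 0 = ?g \<alpha>" for \<alpha>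
    unfolding G_def \<gamma>_def c_def P_def t_def by (rule coeff_pullback_0)
  have M0: "coeff (M \<alpha> $ a) 0 = ?f (\<alpha> + var a)" for \<alpha> a
    unfolding M_def vec_lambda_beta \<phi>_def c_def P_def t_def by (rule coeff_pullback_0)

  define g\<^sub>1 where "g\<^sub>1 \<alpha> = coeff (G \<alpha>) 1" for \<alpha>
  define h where "h \<alpha> = ?f \<alpha> - g\<^sub>1 \<alpha>" for \<alpha>
  have Ag\<^sub>1: "A *v grad g\<^sub>1 \<alpha> = A *v grad ?f \<alpha>" for \<alpha>
  proof -
    have "A' *v grad G \<alpha> = t *s (A' *v M \<alpha>)"
      unfolding grad_G matrix_vector_mul_assoc APA
      by (simp only: mat_vector_mult flip: matrix_vector_mul_assoc)
    hence "(\<Sum>a\<in>UNIV. c (A $ i $ a) * G (\<alpha> + var a)) = t * (\<Sum>a\<in>UNIV. c (A $ i $ a) * M \<alpha> $ a)" for i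
      by (simp add: vec_eq_iff grad_mult_component A'_def map_matrix_def)
        (simp add: matrix_vector_mult_def)
    hence "coeff (\<Sum>a\<in>UNIV. c (A $ i $ a) * G (\<alpha> + var a)) 1 =
        coeff (t * (\<Sum>a\<in>UNIV. c (A $ i $ a) * M \<alpha> $ a)) 1" for i
      by (rule arg_cong)
    moreover have "coeff (t * p) 1 = coeff p 0" for p by (simp add: t_def)
    ultimately show ?thesis
      by (simp add: vec_eq_iff grad_mult_component coeff_sum c_def M0 g\<^sub>1_def)
  qed
  define H where "H \<alpha> = t * c (h \<alpha>) - \<gamma> \<alpha>" for \<alpha>
  have "A' *v grad H \<alpha> = 0" for \<alpha>
  proof -
    have "grad h \<alpha> = grad ?f \<alpha> - grad g\<^sub>1 \<alpha>" by (simp add: vec_eq_iff grad_def h_def)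
    hence "A *v grad h \<alpha> = 0" by (simp add: matrix_vector_mult_diff_distrib Ag\<^sub>1)
    hence "A' *v grad (\<lambda>\<beta>. c (h \<beta>)) \<alpha> = 0"
      unfolding A'_def map_matrix_grad[OF c] by (simp add: vec_eq_iff is_homD[OF c])
    moreover have "A' *v grad \<gamma> \<alpha> = 0"
      unfolding grad_\<gamma> matrix_vector_mul_assoc AA by simp
    moreover have "grad H \<alpha> = t *s grad (\<lambda>\<beta>. c (h \<beta>)) \<alpha> - grad \<gamma> \<alpha>"
      by (simp add: vec_eq_iff grad_def H_def)
    ultimately show ?thesis
      by (simp add: matrix_vector_mult_diff_distrib matrix_vector_mult_smult)
  qed
  hence NH: "N *v grad H \<alpha> = 0 *s grad H \<alpha>" for \<alpha>
    unfolding N_def by (simp flip: matrix_vector_mul_assoc)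

  define F where "F \<alpha> = pCons (?f \<alpha>) (poly_shift 2 (G \<alpha>))" for \<alpha>
  have tF: "t * F \<alpha> = G \<alpha> + H \<alpha>" for \<alpha>
  proof -
    obtain q where q: "poly_shift 2 (G \<alpha>) = q" by blast
    have "G \<alpha> = pCons (?g \<alpha>) (pCons (g\<^sub>1 \<alpha>) q)"
      by (rule poly_eqI) (auto simp: coeff_pCons coeff_poly_shift G0 g\<^sub>1_def q[symmetric] split: nat.split)
    thus ?thesis unfolding F_def q H_def by (simp add: t_def c_def h_def \<gamma>_def)
  qed

  \<comment> \<open>Passage to the field \<open>K(t)\<close>.\<close>
  define j where "j = (ratfun_of_poly :: 'k poly \<Rightarrow> _)"
  have j: "is_hom j" unfolding j_def by (rule is_hom_ratfun_of_poly)
  have j0: "j p = 0 \<longleftrightarrow> p = 0" for p unfolding j_def by (rule ratfun_of_poly_eq_0_iff)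
  have jt: "j t \<noteq> 0" unfolding j0 by (simp add: t_def)
  have sub: "is_subfield (ratfuns 1 :: 'k tpoly fract set)" by (rule is_subfield_ratfuns)
  have jL: "j p \<in> ratfuns 1" for p unfolding j_def by (rule ratfun_of_poly_in_ratfuns)
  define piece where "piece K = form_of d (\<lambda>\<alpha>. j (K \<alpha>) / j t)" for K :: "('r \<Rightarrow>\<^sub>0 nat) \<Rightarrow> 'k poly"
  have piece_homog: "piece K \<in> homog (ratfuns 1) d" for K
    unfolding piece_def by (intro form_of_homog is_subfieldD[OF sub] jL)
  have piece_grad: "map_matrix j N *v grad (Poly_Mapping.lookup (piece K)) \<alpha> =
      j e *s grad (Poly_Mapping.lookup (piece K)) \<alpha>"
    if K: "N *v grad K \<alpha> = e *s grad K \<alpha>" for K e \<alpha>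
  proof (cases "Suc (mdeg \<alpha>) = d")
    case True
    hence eq: "grad (Poly_Mapping.lookup (piece K)) \<alpha> = (1 / j t) *s grad (\<lambda>\<beta>. j (K \<beta>)) \<alpha>"
      by (simp add: vec_eq_iff grad_def piece_def lookup_form_of)
    have "map_matrix j N *v grad (\<lambda>\<beta>. j (K \<beta>)) \<alpha> = j e *s grad (\<lambda>\<beta>. j (K \<beta>)) \<alpha>"
      unfolding map_matrix_grad[OF j] K by (simp add: vec_eq_iff grad_def is_homD[OF j])
    thus ?thesis unfolding eq matrix_vector_mult_smult by (simp add: vec_eq_iff)
  next
    case False
    hence "grad (Poly_Mapping.lookup (piece K)) \<alpha> = 0"
      by (simp add: vec_eq_iff grad_def piece_def lookup_form_of)
    thus ?thesis by (simp only: matrix_vector_mult_0_right vector_smult_rzero)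
  qed
  have piece_nonzero: "piece K \<noteq> 0" if "coeff (K \<alpha>\<^sub>0) 0 \<noteq> 0" for K
  proof
    assume "piece K = 0"
    hence "Poly_Mapping.lookup (piece K) \<alpha>\<^sub>0 = 0" by simp
    hence "K \<alpha>\<^sub>0 = 0" using jt by (simp add: piece_def lookup_form_of \<alpha>\<^sub>0_deg j0)
    thus False using that by simp
  qed
  have "coeff (H \<alpha>\<^sub>0) 0 = - ?g \<alpha>\<^sub>0" by (simp add: H_def t_def \<gamma>_def c_def)
  hence nonzero: "piece G \<noteq> 0" "piece H \<noteq> 0"
    using piece_nonzero[of G] piece_nonzero[of H] \<alpha>\<^sub>0 G0[of \<alpha>\<^sub>0] by simp_all
  have split: "regular_splitting (ratfuns 1) d 2 (piece G + piece H)"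
  proof (rule regular_splitting_two[OF sub f(2) piece_homog nonzero(1) piece_homog nonzero(2) jt])
    show "map_matrix j N *v grad (Poly_Mapping.lookup (piece G)) \<alpha> =
        j t *s grad (Poly_Mapping.lookup (piece G)) \<alpha>" for \<alpha>
      by (rule piece_grad[OF NG])
    show "map_matrix j N *v grad (Poly_Mapping.lookup (piece H)) \<alpha> = 0" for \<alpha>
      using piece_grad[OF NH] by (simp add: is_homD[OF j])
  qed
  define F' where "F' = form_of d (\<lambda>\<alpha>. tpoly_of_poly (F \<alpha>))"
  have lookup_F': "Poly_Mapping.lookup F' \<alpha> = (if mdeg \<alpha> = d then tpoly_of_poly (F \<alpha>) else 0)" for \<alpha>
    by (simp add: F'_def lookup_form_of)
  have "F' \<in> homog (tpolys 1) d"
    unfolding F'_def using tpolys_const[of "0::'k" 1]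
    by (intro form_of_homog tpoly_of_poly_in_tpolys) simp
  moreover have "Poly_Mapping.map (\<lambda>p. Poly_Mapping.lookup p 0) F' = f"
  proof (rule poly_mapping_eqI)
    fix \<alpha>
    have "Poly_Mapping.lookup (Poly_Mapping.map (\<lambda>p. Poly_Mapping.lookup p 0) F') \<alpha> =
        Poly_Mapping.lookup (Poly_Mapping.lookup F' \<alpha>) 0"
      by (simp add: map.rep_eq when_def)
    also have "\<dots> = ?f \<alpha>"
      using f(1) by (simp add: lookup_F' lookup_tpoly_of_poly_0 F_def homog_iff del: tpoly_of_poly_pCons)
    finally show "Poly_Mapping.lookup (Poly_Mapping.map (\<lambda>p. Poly_Mapping.lookup p 0) F') \<alpha> = ?f \<alpha>" .
  qed
  moreover have "Poly_Mapping.map (\<lambda>p. Fract p 1) F' = piece G + piece H"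
  proof (rule poly_mapping_eqI)
    fix \<alpha>
    have "j (F \<alpha>) = j (G \<alpha>) / j t + j (H \<alpha>) / j t"
      using arg_cong[OF tF[of \<alpha>], of j] jt by (simp add: is_homD[OF j] field_simps)
    hence "Poly_Mapping.lookup (piece G + piece H) \<alpha> = (if mdeg \<alpha> = d then j (F \<alpha>) else 0)"
      by (simp add: piece_def lookup_form_of lookup_add)
    also have "\<dots> = Fract (Poly_Mapping.lookup F' \<alpha>) 1"
      by (simp add: lookup_F' j_def ratfun_of_poly_def Zero_fract_def)
    also have "\<dots> = Poly_Mapping.lookup (Poly_Mapping.map (\<lambda>p. Fract p 1) F') \<alpha>"
      by (simp add: map.rep_eq when_def Zero_fract_def)
    finally show "Poly_Mapping.lookup (Poly_Mapping.map (\<lambda>p. Fract p 1) F') \<alpha> =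
        Poly_Mapping.lookup (piece G + piece H) \<alpha>" ..
  qed
  ultimately show ?thesis unfolding degenerate_splitting_def
    using split by (intro exI[of _ "1::nat"] conjI order_refl exI[of _ F']) simp_all
qed

section \<open>Specialization of self-adjoint matrices\<close>

definition total_degree :: "('a \<Rightarrow>\<^sub>0 nat) \<Rightarrow> nat" where
  "total_degree \<gamma> = (\<Sum>k\<in>Poly_Mapping.keys \<gamma>. Poly_Mapping.lookup \<gamma> k)"

lemma total_degree_add: "total_degree (\<gamma> + \<delta>) = total_degree \<gamma> + total_degree \<delta>"
  unfolding total_degree_def by (rule setsum_keys_plus_distrib) auto

lemma total_degree_eq_0: "total_degree \<gamma> = 0 \<Longrightarrow> \<gamma> = 0"
  by (rule poly_mapping_eqI) (auto simp: total_degree_def in_keys_iff)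

text \<open>
  In the product with \<open>q\<close>, the monomials of \<open>p\<close> other than \<open>1\<close> contribute only above the lowest degree of \<open>q\<close>.
\<close>

lemma lookup_mult_lowest:
  fixes p q :: "('a \<Rightarrow>\<^sub>0 nat) \<Rightarrow>\<^sub>0 'k::comm_ring_1"
  assumes low: "\<And>\<epsilon>. Poly_Mapping.lookup q \<epsilon> \<noteq> 0 \<Longrightarrow> total_degree \<gamma> \<le> total_degree \<epsilon>"
  shows "Poly_Mapping.lookup (p * q) \<gamma> = Poly_Mapping.lookup p 0 * Poly_Mapping.lookup q \<gamma>"
proof -
  define \<iota> where "\<iota> \<beta> = (if \<beta> = \<gamma> then 1 else 0 :: 'k)" for \<beta> :: "'a \<Rightarrow>\<^sub>0 nat"
  have lookup: "Poly_Mapping.lookup D \<gamma> = pairing D \<iota>" for D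
    unfolding pairing_def \<iota>_def by (simp add: if_distrib[of "\<lambda>c. _ * c"] in_keys_iff cong: if_cong)
  have "pairing q (\<lambda>\<epsilon>. \<iota> (\<delta> + \<epsilon>)) = (if \<delta> = 0 then Poly_Mapping.lookup q \<gamma> else 0)" for \<delta>
  proof (cases "\<delta> = 0")
    case False
    have "Poly_Mapping.lookup q \<epsilon> * \<iota> (\<delta> + \<epsilon>) = 0" if "\<epsilon> \<in> Poly_Mapping.keys q" for \<epsilon>
    proof -
      have "\<delta> + \<epsilon> \<noteq> \<gamma>"
      proof
        assume "\<delta> + \<epsilon> = \<gamma>"
        hence "total_degree \<delta> = 0"
          using low[of \<epsilon>] that total_degree_add[of \<delta> \<epsilon>] by (auto simp: in_keys_iff)
        thus False using False total_degree_eq_0 by blast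
      qed
      thus ?thesis by (simp add: \<iota>_def)
    qed
    thus ?thesis using False by (simp add: pairing_def)
  qed (simp add: lookup)
  hence "pairing (p * q) \<iota> = pairing p (\<lambda>\<delta>. if \<delta> = 0 then Poly_Mapping.lookup q \<gamma> else 0)"
    by (simp add: pairing_mult)
  also have "\<dots> = Poly_Mapping.lookup p 0 * Poly_Mapping.lookup q \<gamma>"
    unfolding pairing_def by (simp add: if_distrib[of "\<lambda>c. _ * c"] in_keys_iff cong: if_cong)
  finally show ?thesis by (simp only: lookup)
qed

lemma common_denominator:
  fixes x :: "'i \<Rightarrow> 'a::idom fract"
  assumes "finite I"
  obtains b where "b \<noteq> 0" "\<And>i. i \<in> I \<Longrightarrow> \<exists>a. Fract b 1 * x i = Fract a 1"
proof -
  have "\<exists>b. b \<noteq> 0 \<and> (\<forall>i\<in>I. \<exists>a. Fract b 1 * x i = Fract a 1)"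
    using assms
  proof induction
    case empty
    show ?case by (intro exI[of _ 1]) simp
  next
    case (insert i I)
    then obtain b where b: "b \<noteq> 0" "\<And>k. k \<in> I \<Longrightarrow> \<exists>a. Fract b 1 * x k = Fract a 1" by blast
    obtain a c where x: "x i = Fract a c" "c \<noteq> 0" by (cases "x i") auto
    have "\<exists>a. Fract (b * c) 1 * x k = Fract a 1" if k: "k \<in> insert i I" for k
    proof (cases "k = i")
      case True
      have "Fract (b * c) 1 * x k = Fract (b * a) 1" using x True by (simp add: eq_fract)
      thus ?thesis by blast
    next
      case False
      then obtain e where e: "Fract b 1 * x k = Fract e 1" using b(2) k by blast
      have "Fract (b * c) 1 = Fract c 1 * Fract b 1" by (simp add: mult.commute)
      hence "Fract (b * c) 1 * x k = Fract c 1 * (Fract b 1 * x k)" by (simp only: mult.assoc)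
      hence "Fract (b * c) 1 * x k = Fract (c * e) 1" by (simp add: e)
      thus ?thesis by blast
    qed
    thus ?case using b(1) x(2) by (intro exI[of _ "b * c"]) simp
  qed
  thus thesis using that by blast
qed

text \<open>
  Being self-adjoint for a form is a system of linear equations on the entries of a matrix. A
  non-scalar solution over \<open>K(t)\<close>, normalized to have a zero on the diagonal and cleared of
  denominators, is a nonzero solution over \<open>K[t]\<close>. Its terms of lowest degree in \<open>t\<close> solve the
  system at \<open>t = 0\<close>, and they inherit the zero on the diagonal.
\<close>

lemma nonscalar_specialization:
  fixes F :: "('r::finite \<Rightarrow>\<^sub>0 nat) \<Rightarrow> 'k::field tpoly"
  assumes A: "self_adjoint A (\<lambda>\<alpha>. Fract (F \<alpha>) 1)" "A \<notin> range mat"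
  obtains A\<^sub>0 where "self_adjoint A\<^sub>0 (\<lambda>\<alpha>. Poly_Mapping.lookup (F \<alpha>) 0)" "A\<^sub>0 \<notin> range mat"
proof -
  fix i\<^sub>0 :: 'r
  define B where "B = A - mat (A $ i\<^sub>0 $ i\<^sub>0)"
  have B: "self_adjoint B (\<lambda>\<alpha>. Fract (F \<alpha>) 1)"
    unfolding B_def by (intro self_adjoint_diff A(1) self_adjoint_mat)
  have "B \<noteq> 0" using A(2) by (auto simp: B_def)
  have B0: "B $ i\<^sub>0 $ i\<^sub>0 = 0" by (simp add: B_def mat_def)
  obtain b where b: "b \<noteq> 0" "\<And>ij. ij \<in> UNIV \<Longrightarrow> \<exists>a. Fract b 1 * B $ fst ij $ snd ij = Fract a 1"
    by (rule common_denominator[of "UNIV :: ('r \<times> 'r) set" "\<lambda>ij. B $ fst ij $ snd ij"]) auto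
  have "\<forall>i j. \<exists>a. Fract b 1 * B $ i $ j = Fract a 1"
  proof (intro allI)
    show "\<exists>a. Fract b 1 * B $ i $ j = Fract a 1" for i j using b(2)[of "(i, j)"] by simp
  qed
  then obtain C where C: "\<And>i j. Fract b 1 * B $ i $ j = Fract (C i j) 1" by metis
  have b': "Fract b 1 \<noteq> 0" using b(1) by (simp add: Fract_1_eq_0_iff)
  have C_eq_0: "C i j = 0 \<longleftrightarrow> B $ i $ j = 0" for i j
    using C[of i j] b' by (metis Fract_1_eq_0_iff mult_eq_0_iff)
  have C_eq: "(\<Sum>a\<in>UNIV. F (\<alpha> + var j + var a) * C i a) = (\<Sum>a\<in>UNIV. F (\<alpha> + var i + var a) * C j a)" for \<alpha> i j
  proof -
    have frac: "Fract (\<Sum>a\<in>UNIV. F (\<alpha> + var l + var a) * C k a) 1 =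
        Fract b 1 * (B *v grad (\<lambda>\<alpha>. Fract (F \<alpha>) 1) (\<alpha> + var l)) $ k" for k l
    proof -
      have "Fract (\<Sum>a\<in>UNIV. F (\<alpha> + var l + var a) * C k a) 1 =
          (\<Sum>a\<in>UNIV. Fract (F (\<alpha> + var l + var a)) 1 * Fract (C k a) 1)"
        by (simp add: is_hom_sum[OF is_hom_Fract])
      also have "\<dots> = (\<Sum>a\<in>UNIV. Fract b 1 * (B $ k $ a * Fract (F (\<alpha> + var l + var a)) 1))"
        unfolding C[symmetric] by (simp only: mult.assoc mult.commute mult.left_commute)
      finally show ?thesis by (simp only: grad_mult_component sum_distrib_left)
    qed
    have "Fract (\<Sum>a\<in>UNIV. F (\<alpha> + var j + var a) * C i a) 1 =
        Fract (\<Sum>a\<in>UNIV. F (\<alpha> + var i + var a) * C j a) 1"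
      unfolding frac using B unfolding self_adjoint_iff_grad by metis
    thus ?thesis by (simp add: eq_fract)
  qed

  define T where "T = {\<gamma>. \<exists>i j. Poly_Mapping.lookup (C i j) \<gamma> \<noteq> 0}"
  obtain i j where "B $ i $ j \<noteq> 0" using \<open>B \<noteq> 0\<close> by (auto simp: vec_eq_iff)
  hence "C i j \<noteq> 0" by (simp add: C_eq_0)
  then obtain \<delta> where "Poly_Mapping.lookup (C i j) \<delta> \<noteq> 0" by (metis poly_mapping_eqI lookup_zero)
  hence "\<delta> \<in> T" unfolding T_def by blast
  from ex_has_least_nat[of "\<lambda>\<gamma>. \<gamma> \<in> T", OF this, of total_degree]
  obtain \<gamma> where \<gamma>: "\<gamma> \<in> T" "\<And>\<epsilon>. \<epsilon> \<in> T \<Longrightarrow> total_degree \<gamma> \<le> total_degree \<epsilon>" by blast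
  have low: "Poly_Mapping.lookup (p * C i j) \<gamma> = Poly_Mapping.lookup p 0 * Poly_Mapping.lookup (C i j) \<gamma>" for p i j
  proof (rule lookup_mult_lowest)
    fix \<epsilon> assume "Poly_Mapping.lookup (C i j) \<epsilon> \<noteq> 0"
    hence "\<epsilon> \<in> T" unfolding T_def by blast
    thus "total_degree \<gamma> \<le> total_degree \<epsilon>" by (rule \<gamma>(2))
  qed
  define A\<^sub>0 where "A\<^sub>0 = (\<chi> i j. Poly_Mapping.lookup (C i j) \<gamma>)"
  have "self_adjoint A\<^sub>0 (\<lambda>\<alpha>. Poly_Mapping.lookup (F \<alpha>) 0)"
    unfolding self_adjoint_iff_grad
  proof (intro allI)
    fix \<alpha> i j
    have "Poly_Mapping.lookup (\<Sum>a\<in>UNIV. F (\<alpha> + var j + var a) * C i a) \<gamma> =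
        Poly_Mapping.lookup (\<Sum>a\<in>UNIV. F (\<alpha> + var i + var a) * C j a) \<gamma>"
      by (simp only: C_eq)
    thus "(A\<^sub>0 *v grad (\<lambda>\<alpha>. Poly_Mapping.lookup (F \<alpha>) 0) (\<alpha> + var j)) $ i =
        (A\<^sub>0 *v grad (\<lambda>\<alpha>. Poly_Mapping.lookup (F \<alpha>) 0) (\<alpha> + var i)) $ j"
      unfolding grad_mult_component lookup_sum low A\<^sub>0_def vec_lambda_beta by (simp only: mult.commute)
  qed
  moreover have "A\<^sub>0 \<notin> range mat"
  proof
    assume "A\<^sub>0 \<in> range mat"
    then obtain c where c: "A\<^sub>0 = mat c" by blast
    have "C i\<^sub>0 i\<^sub>0 = 0" by (simp add: C_eq_0 B0)
    hence "A\<^sub>0 $ i\<^sub>0 $ i\<^sub>0 = 0" by (simp add: A\<^sub>0_def)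
    hence "c = 0" by (simp add: c mat_def)
    hence "A\<^sub>0 = 0" using c by simp
    hence "Poly_Mapping.lookup (C i j) \<gamma> = 0" for i j by (simp add: A\<^sub>0_def vec_eq_iff)
    thus False using \<gamma>(1) by (simp add: T_def)
  qed
  ultimately show thesis by (rule that)
qed

lemma degenerate_splitting_imp_nonscalar:
  fixes f :: "('r::finite, 'k::field) dpow"
  assumes "d > 0" "m \<ge> 2" "degenerate_splitting d m f"
  obtains A where "self_adjoint A (Poly_Mapping.lookup f)" "A \<notin> range mat"
proof -
  obtain n and F :: "('r, 'k tpoly) dpow" where
    f: "Poly_Mapping.map (\<lambda>p. Poly_Mapping.lookup p 0) F = f" and
    split: "regular_splitting (ratfuns n) d m (Poly_Mapping.map (\<lambda>p. Fract p 1) F)"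
    using assms(3) unfolding degenerate_splitting_def by blast
  have "Poly_Mapping.lookup (Poly_Mapping.map (\<lambda>p. Fract p 1) F) = (\<lambda>\<alpha>. Fract (Poly_Mapping.lookup F \<alpha>) 1)"
    by (rule ext) (simp add: map.rep_eq when_def Zero_fract_def)
  moreover have "Poly_Mapping.lookup f = (\<lambda>\<alpha>. Poly_Mapping.lookup (Poly_Mapping.lookup F \<alpha>) 0)"
    unfolding f[symmetric] by (rule ext) (simp add: map.rep_eq when_def)
  ultimately show thesis
    using regular_splitting_imp_nonscalar[OF is_subfield_ratfuns assms(1,2) split]
      nonscalar_specialization[of _ "Poly_Mapping.lookup F"] that by metis
qed

lemma nonscalar_imp_splitting:
  fixes f :: "('r::finite, 'k::alg_closed_field) dpow"
  assumes f: "f \<in> homog UNIV d" "d > 0" and nd: "ann f \<inter> homog UNIV 1 = {0}"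
    and A: "self_adjoint A (Poly_Mapping.lookup f)" "A \<notin> range mat"
  shows "regular_splitting UNIV d 2 f \<or> degenerate_splitting d 2 f"
proof -
  obtain p where p: "mat_poly A p \<noteq> 0"
    "mat_poly A p ** mat_poly A p = mat_poly A p \<and> mat_poly A p \<noteq> mat 1 \<or>
      mat_poly A p ** mat_poly A p = 0"
    using idempotent_or_nilpotent_poly[OF A(2)] unfolding Let_def by blast
  have "self_adjoint (mat_poly A p) (Poly_Mapping.lookup f)"
    by (rule self_adjoint_mat_poly[OF A(1)])
  thus ?thesis
    using p idempotent_imp_regular_splitting[OF f nd] square_zero_imp_degenerate_splitting[OF f nd]
    by metis
qed

theorem corollary4p7:
  fixes f :: "('r::finite, 'k::alg_closed_field) dpow" and d :: nat
  assumes "d \<ge> 3"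
    and "f \<in> homog UNIV d"
    and "ann f \<inter> homog UNIV 1 = {0}"
  shows "(\<exists>m\<ge>2. regular_splitting UNIV d m f \<or> degenerate_splitting d m f) \<longleftrightarrow>
    min_num_gens (ann f) d > 0"
proof
  have d: "d > 0" using assms(1) by simp
  {
    assume "\<exists>m\<ge>2. regular_splitting UNIV d m f \<or> degenerate_splitting d m f"
    then obtain m where m: "m \<ge> 2" "regular_splitting UNIV d m f \<or> degenerate_splitting d m f"
      by blast
    obtain A where "self_adjoint A (Poly_Mapping.lookup f)" "A \<notin> range mat"
      using m(2)
    proof
      assume "regular_splitting UNIV d m f"
      thus thesis using regular_splitting_imp_nonscalar[OF is_subfield_UNIV d m(1)] that by blast
    next
      assume "degenerate_splitting d m f"
      thus thesis using degenerate_splitting_imp_nonscalar[OF d m(1)] that by blast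
    qed
    thus "min_num_gens (ann f) d > 0"
      by (rule nonscalar_imp_min_num_gens_pos[OF assms(2) d assms(3)])
  }
  assume "min_num_gens (ann f) d > 0"
  then obtain A where "self_adjoint A (Poly_Mapping.lookup f)" "A \<notin> range mat"
    by (rule min_num_gens_pos_imp_nonscalar[OF assms(2) d])
  from nonscalar_imp_splitting[OF assms(2) d assms(3) this]
  show "\<exists>m\<ge>2. regular_splitting UNIV d m f \<or> degenerate_splitting d m f" by blast
qed

end
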